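(* Let $\mathcal{X}$ be a spike prior, and let $\mathcal{P},\mathcal{P}_d$ be probability distributions on $\mathbb{R}$, where $\mathcal{P}$ has mean $0$ and variance $1$. Assume: (i) $\mathcal{X}$ is $(\sigma^2/n)$-subgaussian (i.e. $x\sim\mathcal{X}_n$ is a $(\sigma^2/n)$-subgaussian random vector) for some constant $\sigma^2$; (ii) for each $q\in\{2,4,6,8\}$ there exists a constant $\alpha_q$ such that, with probability $1-o(1)$ over $x\sim\mathcal{X}_n$, $\|x\|_q\le\alpha_q n^{\frac1q-\frac12}$; (iii) $\mathcal{P},\mathcal{P}_d$ have non-vanishing density functions $p,p_d$, and their translation functions $\tau,\tau_d$ are $C^4$ in a neighborhood of $(0,0)$. Then for all $\lambda\ge0$ with $\lambda<\lambda^*_{\mathcal{X}}/\sqrt{F_{\mathcal{P}}}$, $\mathrm{Wig}(\lambda,\mathcal{P},\mathcal{P}_d,\mathcal{X})$ is contiguous to $\mathrm{Wig}(0,\mathcal{P},\mathcal{P}_d)$.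
   Context: A spike prior is a family $\mathcal{X}=\{\mathcal{X}_n\}$, where $\mathcal{X}_n$ is a probability distribution on $\mathbb{R}^n$ such that for $x\sim\mathcal{X}_n$, $\|x\|\to1$ in probability as $n\to\infty$. General spiked Wigner model: $\mathrm{Wig}(\lambda,\mathcal{P},\mathcal{P}_d,\mathcal{X})$ is the sequence (in $n$) of distributions of the $n\times n$ matrix $Y=\lambda xx^\top+\frac1{\sqrt n}W$, where $x\sim\mathcal{X}_n$ and, independently, $W$ is symmetric with entries independent up to symmetry, off-diagonal entries distributed as $\mathcal{P}$ and diagonal entries distributed as $\mathcal{P}_d$. $\mathrm{Wig}(0,\mathcal{P},\mathcal{P}_d)$ is the case $\lambda=0$. An $\mathbb{R}^n$-valued random variable $X$ is $\sigma^2$-subgaussian if $\mathbb{E}X=0$ and $\mathbb{E}\exp(\langle v,X\rangle)\le\exp(\sigma^2\|v\|^2/2)$ for all $v\in\mathbb{R}^n$. Translation function: $\tau(a,b)=\log\mathbb{E}_{z\sim\mathcal{P}}\left[\frac{p(z-a)}{p(z)}\frac{p(z-b)}{p(z)}\right]$; $\tau_d$ is defined in the same way from $\mathcal{P}_d$ and $p_d$. Fisher information: $F_{\mathcal{P}}=\mathbb{E}_{w\sim\mathcal{P}}\left[\left(\frac{p'(w)}{p(w)}\right)^2\right]=\int_{-\infty}^\infty\frac{p'(w)^2}{p(w)}\,dw$, where the density $p$ is assumed differentiable so that this is defined. With $x,x'$ drawn independently from $\mathcal{X}_n$, $$\lambda^*_{\mathcal{X}}=\sup\left\{\lambda\;\Big|\;\mathbb{E}_{x,x'}\exp\left(\frac{n\lambda^2}2\langle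 x,x'\rangle^2\right)\text{ is bounded as }n\to\infty\right\}.$$ A sequence of distributions $Q_n$ is contiguous to $P_n$ if for every sequence of events $A_n$, $P_n(A_n)\to0$ implies $Q_n(A_n)\to0$. *)

theory Defs
  imports "HOL-Probability.Probability"
begin

text \<open>
  A vector in \<open>\<real>\<^sup>n\<close> is a function \<open>nat \<Rightarrow> real\<close> of which only the values on \<open>{..<n}\<close> matter, so
  that \<open>n\<close> can vary; distributions on \<open>\<real>\<^sup>n\<close> live on the product space \<open>\<Pi>\<^sub>M i\<in>{..<n}. borel\<close>.
  Likewise an \<open>n \<times> n\<close> matrix is indexed by \<open>{..<n} \<times> {..<n}\<close>.  The Euclidean norm of \<open>x\<close> is
  \<open>L2_set x {..<n}\<close>.
\<close>

abbreviation vec_space :: "nat \<Rightarrow> (nat \<Rightarrow> real) measure" where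
  "vec_space n \<equiv> \<Pi>\<^sub>M i\<in>{..<n}. borel"

abbreviation mat_space :: "nat \<Rightarrow> (nat \<times> nat \<Rightarrow> real) measure" where
  "mat_space n \<equiv> \<Pi>\<^sub>M ij\<in>{..<n} \<times> {..<n}. borel"

definition dot :: "nat \<Rightarrow> (nat \<Rightarrow> real) \<Rightarrow> (nat \<Rightarrow> real) \<Rightarrow> real" where
  "dot n x y = (\<Sum>i<n. x i * y i)"

definition lq_norm :: "real \<Rightarrow> nat \<Rightarrow> (nat \<Rightarrow> real) \<Rightarrow> real" where
  "lq_norm q n x = (\<Sum>i<n. \<bar>x i\<bar> powr q) powr (1 / q)"

definition spike_prior :: "(nat \<Rightarrow> (nat \<Rightarrow> real) measure) \<Rightarrow> bool" where
  "spike_prior X \<longleftrightarrow>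
     (\<forall>n. prob_space (X n) \<and> sets (X n) = sets (vec_space n)) \<and>
     (\<forall>\<epsilon>>0. (\<lambda>n. measure (X n) {x \<in> space (X n). \<bar>L2_set x {..<n} - 1\<bar> > \<epsilon>}) \<longlonglongrightarrow> 0)"

definition subgaussian :: "nat \<Rightarrow> real \<Rightarrow> (nat \<Rightarrow> real) measure \<Rightarrow> bool" where
  "subgaussian n s M \<longleftrightarrow>
     (\<forall>i<n. integrable M (\<lambda>x. x i) \<and> (\<integral>x. x i \<partial>M) = 0) \<and>
     (\<forall>v. (\<integral>\<^sup>+ x. ennreal (exp (dot n v x)) \<partial>M) \<le> ennreal (exp (s * (L2_set v {..<n})\<^sup>2 / 2)))"

text \<open>
  The noise matrix \<open>W\<close> is sampled through its independent entries \<open>(i, j)\<close> with \<open>i \<le> j\<close>; the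
  entries below the diagonal are read off by symmetry.
\<close>

definition wigner_noise :: "real measure \<Rightarrow> real measure \<Rightarrow> nat \<Rightarrow> (nat \<times> nat \<Rightarrow> real) measure" where
  "wigner_noise P Pd n =
     (\<Pi>\<^sub>M ij\<in>{(i, j). i \<le> j \<and> j < n}. if fst ij = snd ij then Pd else P)"

definition spiked_matrix ::
  "real \<Rightarrow> nat \<Rightarrow> (nat \<Rightarrow> real) \<Rightarrow> (nat \<times> nat \<Rightarrow> real) \<Rightarrow> nat \<times> nat \<Rightarrow> real" where
  "spiked_matrix lam n x w =
     (\<lambda>(i, j)\<in>{..<n} \<times> {..<n}. lam * (x i * x j) + w (min i j, max i j) / sqrt (real n))"

definition Wig ::
  "real \<Rightarrow> real measure \<Rightarrow> real measure \<Rightarrow> (nat \<Rightarrow> (nat \<Rightarrow> real) measure) \<Rightarrow>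
   nat \<Rightarrow> (nat \<times> nat \<Rightarrow> real) measure" where
  "Wig lam P Pd X n =
     distr (X n \<Otimes>\<^sub>M wigner_noise P Pd n) (mat_space n) (\<lambda>(x, w). spiked_matrix lam n x w)"

definition contiguous :: "(nat \<Rightarrow> 'a measure) \<Rightarrow> (nat \<Rightarrow> 'a measure) \<Rightarrow> bool" where
  "contiguous Q P \<longleftrightarrow>
     (\<forall>A. (\<forall>n. A n \<in> sets (P n)) \<longrightarrow> (\<lambda>n. measure (P n) (A n)) \<longlonglongrightarrow> 0 \<longrightarrow>
          (\<lambda>n. measure (Q n) (A n)) \<longlonglongrightarrow> 0)"

definition nonvanishing_density :: "real measure \<Rightarrow> (real \<Rightarrow> real) \<Rightarrow> bool" where
  "nonvanishing_density P p \<longleftrightarrow>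
     p \<in> borel_measurable borel \<and> (\<forall>w. p w > 0) \<and> P = density lborel (\<lambda>w. ennreal (p w))"

definition translation_integrand :: "(real \<Rightarrow> real) \<Rightarrow> real \<times> real \<Rightarrow> real \<Rightarrow> real" where
  "translation_integrand p ab z = p (z - fst ab) / p z * (p (z - snd ab) / p z)"

definition translation_function :: "real measure \<Rightarrow> (real \<Rightarrow> real) \<Rightarrow> real \<times> real \<Rightarrow> real" where
  "translation_function P p ab = ln (\<integral>z. translation_integrand p ab z \<partial>P)"

text \<open>
  Class \<open>C\<^sup>k\<close> on an open set \<open>S\<close>: the function is differentiable with a derivative all of whose
  directional components are of class \<open>C\<^sup>k\<^sup>-\<^sup>1\<close>.
\<close>

primrec Ck_on ::
  "nat \<Rightarrow> 'a::euclidean_space set \<Rightarrow> ('a \<Rightarrow> 'b::real_normed_vector) \<Rightarrow> bool" where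
  "Ck_on 0 S f \<longleftrightarrow> continuous_on S f"
| "Ck_on (Suc k) S f \<longleftrightarrow>
     (\<exists>f'. (\<forall>x\<in>S. (f has_derivative f' x) (at x)) \<and> (\<forall>v. Ck_on k S (\<lambda>x. f' x v)))"

text \<open>
  Being \<open>C\<^sup>4\<close> near the origin includes being finite there: the expectation in the translation
  function has to converge, since a divergent Bochner integral would be read as \<open>0\<close>.
\<close>

definition translation_C4_near_0 :: "real measure \<Rightarrow> (real \<Rightarrow> real) \<Rightarrow> bool" where
  "translation_C4_near_0 P p \<longleftrightarrow>
     (\<exists>U. open U \<and> (0, 0) \<in> U \<and> (\<forall>ab\<in>U. integrable P (translation_integrand p ab)) \<and>
          Ck_on 4 U (translation_function P p))"

text \<open>
  For a differentiable positive density whose translation function is \<open>C\<^sup>2\<close> near the origin the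
  Fisher information is finite and positive, so neither the Bochner integral here nor a division
  by its square root is degenerate.
\<close>

definition fisher_information :: "real measure \<Rightarrow> (real \<Rightarrow> real) \<Rightarrow> real" where
  "fisher_information P p = (\<integral>w. (deriv p w / p w)\<^sup>2 \<partial>P)"

text \<open>
  The second moment may be infinite for some \<open>n\<close>, and the supremum is taken in the extended reals.
  Boundedness as \<open>n \<rightarrow> \<infinity>\<close> concerns all sufficiently large \<open>n\<close>.
\<close>

definition lambda_star :: "(nat \<Rightarrow> (nat \<Rightarrow> real) measure) \<Rightarrow> ereal" where
  "lambda_star X =
     (SUP lam\<in>{lam :: real. \<exists>C :: real. \<forall>\<^sub>F n in sequentially.
          (\<integral>\<^sup>+ (x, x'). ennreal (exp (real n * lam\<^sup>2 / 2 * (dot n x x')\<^sup>2)) \<partial>(X n \<Otimes>\<^sub>M X n))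
            \<le> ennreal C}. ereal lam)"

end

theory Submission
  imports Defs "HOL-Real_Asymp.Real_Asymp"
begin

text \<open>
  Second moment method, with the spike restricted to the event that its \<open>q\<close>-norms are of the order
  of a delocalized vector for \<open>q = 2, 4, 6, 8\<close>.  The second moment of the truncated likelihood ratio is
  the expectation, over two independent spikes \<open>x\<close>, \<open>x'\<close>, of the exponential of a sum of translation
  functions at \<open>a = \<lambda> \<surd>n x\<^sub>i x\<^sub>j\<close>, \<open>b = \<lambda> \<surd>n x'\<^sub>i x'\<^sub>j\<close>.  Since \<open>\<tau>\<close> vanishes on both axes,
  \<open>\<tau> (a, b) = h a b + c\<^sub>1 a\<^sup>2 b + c\<^sub>2 a b\<^sup>2 + O(\<bar>a b\<bar> (a\<^sup>2 + b\<^sup>2))\<close> with \<open>h\<close> at most the Fisher information.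
  The first term gives \<open>h \<lambda>\<^sup>2 n \<langle>x, x'\<rangle>\<^sup>2 / 2\<close>, which is subcritical; the cubic terms give
  \<open>n\<^sup>3\<^sup>/\<^sup>2 \<langle>x\<^sup>2, x'\<rangle>\<^sup>2\<close>, harmless because \<open>x'\<close> is subgaussian and \<open>x\<^sup>2\<close> has squared norm \<open>O(1 / n)\<close>;
  the remainder and the diagonal are bounded.
\<close>

section \<open>Taylor expansion of functions vanishing on the axes\<close>

text \<open>Truncation serves two ends. The translation functions are controlled only near the
  origin, so all their arguments must be small at once: the 8-norm gives |x_i| = O(n^(-3/8)), hence
  a = O(n^(-1/4)). And a spike outside the truncation is never compared by likelihood; it only adds
  its probability, which is o(1).

  The pieces of the exponent depend on the same pair of spikes, so the expectation of the
  exponential does not factor. Strictness of the assumption on lam leaves a ratio \<theta> < 1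
  between F lam^2 and some admissible \<mu>^2.

  Inner products arise because each monomial in a and b is a function of i times the same function
  of j, so that its sum over i < j is half of a square minus a diagonal.\<close>

lemma abs_le_of_deriv_bound:
  fixes f f' :: "real \<Rightarrow> real"
  assumes "f 0 = 0" and "\<And>s. \<bar>s\<bar> \<le> \<bar>a\<bar> \<Longrightarrow> (f has_real_derivative f' s) (at s)"
    and "\<And>s. \<bar>s\<bar> \<le> \<bar>a\<bar> \<Longrightarrow> \<bar>f' s\<bar> \<le> B"
  shows "\<bar>f a\<bar> \<le> B * \<bar>a\<bar>"
proof -
  have "norm (f a - f 0) \<le> B * norm (a - 0)"
  proof (rule field_differentiable_bound[where S = "{-\<bar>a\<bar>..\<bar>a\<bar>}"])
    fix z assume "z \<in> {-\<bar>a\<bar>..\<bar>a\<bar>}"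
    then have z: "\<bar>z\<bar> \<le> \<bar>a\<bar>" by auto
    show "(f has_field_derivative f' z) (at z within {-\<bar>a\<bar>..\<bar>a\<bar>})"
      using assms(2)[OF z] by (rule has_field_derivative_at_within)
    show "norm (f' z) \<le> B" using assms(3)[OF z] by simp
  qed auto
  with assms(1) show ?thesis by simp
qed

text \<open>Differentiability at one point bounds increments taken from that point, which is what an
  expansion about the origin consumes.\<close>

lemma has_derivative_imp_local_lipschitz:
  fixes f :: "'a::real_normed_vector \<Rightarrow> 'b::real_normed_vector"
  assumes "(f has_derivative f') (at x)"
  obtains K d where "K \<ge> 0" "d > 0" "\<And>y. norm (y - x) < d \<Longrightarrow> norm (f y - f x) \<le> K * norm (y - x)"
proof -
  have bl: "bounded_linear f'" using assms by (rule has_derivative_bounded_linear)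
  obtain K where K: "K \<ge> 0" "\<And>v. norm (f' v) \<le> norm v * K"
    using bounded_linear.nonneg_bounded[OF bl] by blast
  have "\<forall>e>0. \<exists>d>0. \<forall>y. norm (y - x) < d \<longrightarrow> norm (f y - f x - f' (y - x)) \<le> e * norm (y - x)"
    using assms by (simp add: has_derivative_at_alt)
  from this[rule_format, of 1] obtain d where
    d: "d > 0" "\<And>y. norm (y - x) < d \<Longrightarrow> norm (f y - f x - f' (y - x)) \<le> norm (y - x)"
    by auto
  show ?thesis
  proof (rule that[of "1 + K" d])
    fix y assume y: "norm (y - x) < d"
    have "norm (f y - f x) = norm ((f y - f x - f' (y - x)) + f' (y - x))" by simp
    also have "\<dots> \<le> norm (y - x) + norm (y - x) * K"
      using d(2)[OF y] K(2)[of "y - x"] by (meson add_mono norm_triangle_le)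
    finally show "norm (f y - f x) \<le> (1 + K) * norm (y - x)" by (simp add: algebra_simps)
  qed (use K d in auto)
qed

lemma norm_Pair_le_sum: "norm (a, b) \<le> \<bar>a\<bar> + \<bar>b\<bar>" for a b :: real
  using norm_Pair_le[of a b] by simp

lemma has_derivative_fst_line:
  fixes f :: "real \<times> real \<Rightarrow> real"
  assumes "(f has_derivative f') (at (s, b))"
  shows "((\<lambda>s. f (s, b)) has_real_derivative f' (1, 0)) (at s)"
proof -
  have lin: "linear f'" using assms by (simp add: has_derivative_bounded_linear bounded_linear.linear)
  have "((\<lambda>s. (s, b)) has_derivative (\<lambda>h. (h, 0))) (at s)"
    by (auto intro!: derivative_eq_intros)
  from has_derivative_compose[OF this assms]
  have "((\<lambda>s. f (s, b)) has_derivative (\<lambda>h. f' (h, 0))) (at s)" by simp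
  moreover have "f' (h, 0) = f' (1, 0) * h" for h
    using linear_scale[OF lin, of h "(1, 0)"] by simp
  then have "(*) (f' (1, 0)) = (\<lambda>h. f' (h, 0))" by (intro ext) (rule sym)
  ultimately show ?thesis unfolding has_field_derivative_def by (elim ssubst)
qed

lemma has_derivative_snd_line:
  fixes f :: "real \<times> real \<Rightarrow> real"
  assumes "(f has_derivative f') (at (a, t))"
  shows "((\<lambda>t. f (a, t)) has_real_derivative f' (0, 1)) (at t)"
proof -
  have lin: "linear f'" using assms by (simp add: has_derivative_bounded_linear bounded_linear.linear)
  have "((\<lambda>t. (a, t)) has_derivative (\<lambda>h. (0, h))) (at t)"
    by (auto intro!: derivative_eq_intros)
  from has_derivative_compose[OF this assms]
  have "((\<lambda>t. f (a, t)) has_derivative (\<lambda>h. f' (0, h))) (at t)" by simp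
  moreover have "f' (0, h) = f' (0, 1) * h" for h
    using linear_scale[OF lin, of h "(0, 1)"] by simp
  then have "(*) (f' (0, 1)) = (\<lambda>h. f' (0, h))" by (intro ext) (rule sym)
  ultimately show ?thesis unfolding has_field_derivative_def by (elim ssubst)
qed

lemma has_derivative_ray:
  fixes f :: "real \<times> real \<Rightarrow> real"
  assumes "(f has_derivative f') (at (t * a, t * b))"
  shows "((\<lambda>t. f (t * a, t * b)) has_real_derivative a * f' (1, 0) + b * f' (0, 1)) (at t)"
proof -
  have lin: "linear f'" using assms by (simp add: has_derivative_bounded_linear bounded_linear.linear)
  have "((\<lambda>t. (t * a, t * b)) has_derivative (\<lambda>h. (h * a, h * b))) (at t)"
    by (auto intro!: derivative_eq_intros)
  from has_derivative_compose[OF this assms]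
  have "((\<lambda>t. f (t * a, t * b)) has_derivative (\<lambda>h. f' (h * a, h * b))) (at t)" by simp
  moreover have "f' (h * a, h * b) = (a * f' (1, 0) + b * f' (0, 1)) * h" for h
  proof -
    have "f' (h * a, h * b) = f' ((h * a) *\<^sub>R (1, 0) + (h * b) *\<^sub>R (0, 1))" by simp
    also have "\<dots> = (h * a) *\<^sub>R f' (1, 0) + (h * b) *\<^sub>R f' (0, 1)"
      using lin by (simp only: linear_add linear_scale)
    finally show ?thesis by (simp add: algebra_simps)
  qed
  then have "(*) (a * f' (1, 0) + b * f' (0, 1)) = (\<lambda>h. f' (h * a, h * b))"
    by (intro ext) (rule sym)
  ultimately show ?thesis unfolding has_field_derivative_def by (elim ssubst)
qed

text \<open>Along the ray through (a, b) the derivative of \<open>g\<close> differs from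
  \<open>c1 * a + c2 * b\<close> only by the increments of the two partials from the origin. These
  are linear in |a| + |b|, and multiplying them by a and b makes the error quadratic.\<close>

lemma C2_taylor_at_0:
  fixes g :: "real \<times> real \<Rightarrow> real"
  assumes "open U" "(0, 0) \<in> U" "Ck_on 2 U g"
  obtains c1 c2 C d where "C \<ge> 0" "d > 0"
    "\<And>a b. \<bar>a\<bar> \<le> d \<Longrightarrow> \<bar>b\<bar> \<le> d \<Longrightarrow>
       (a, b) \<in> U \<and> \<bar>g (a, b) - g (0, 0) - c1 * a - c2 * b\<bar> \<le> C * (a\<^sup>2 + b\<^sup>2)"
proof -
  obtain g' where g': "\<And>x. x \<in> U \<Longrightarrow> (g has_derivative g' x) (at x)"
    and gk: "\<And>v. Ck_on 1 U (\<lambda>x. g' x v)"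
    using assms(3) by (auto simp: numeral_2_eq_2)
  have d0: "\<exists>D. ((\<lambda>x. g' x v) has_derivative D) (at (0, 0))" for v
    using gk[of v] assms(2) by auto
  obtain D1 D2 where "((\<lambda>x. g' x (1, 0)) has_derivative D1) (at (0, 0))"
    and "((\<lambda>x. g' x (0, 1)) has_derivative D2) (at (0, 0))" using d0 by blast
  then obtain K1 d1 K2 d2 where K1: "K1 \<ge> 0" "d1 > 0"
      "\<And>y. norm (y - (0, 0)) < d1 \<Longrightarrow> norm (g' y (1, 0) - g' (0, 0) (1, 0)) \<le> K1 * norm (y - (0, 0))"
    and K2: "K2 \<ge> 0" "d2 > 0"
      "\<And>y. norm (y - (0, 0)) < d2 \<Longrightarrow> norm (g' y (0, 1) - g' (0, 0) (0, 1)) \<le> K2 * norm (y - (0, 0))"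
    by (metis has_derivative_imp_local_lipschitz)
  obtain e where e: "e > 0" "ball (0, 0) e \<subseteq> U" using assms(1,2) by (meson openE)
  \<comment> \<open>With a third, \<open>norm (a, b)\<close> is at most |a| + |b| \<le> 2 d,
    strictly inside all three radii.\<close>
  define d where "d = min e (min d1 d2) / 3"
  define K where "K = K1 + K2"
  define c1 c2 where "c1 = g' (0, 0) (1, 0)" and "c2 = g' (0, 0) (0, 1)"
  have d: "d > 0" using K1 K2 e by (simp add: d_def)
  have small: "norm (a, b) < e \<and> norm (a, b) < d1 \<and> norm (a, b) < d2"
    if "\<bar>a\<bar> \<le> d" "\<bar>b\<bar> \<le> d" for a b :: real
    using norm_Pair_le_sum[of a b] that d unfolding d_def by linarith
  have inU: "(a, b) \<in> U" if "\<bar>a\<bar> \<le> d" "\<bar>b\<bar> \<le> d" for a b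
  proof -
    have "dist (0, 0) (a, b) = norm (a, b)" by (simp add: norm_Pair dist_Pair_Pair)
    then show ?thesis using small[OF that] e(2) by auto
  qed
  show ?thesis
  proof (rule that[of "2 * K" d c1 c2])
    fix a b :: real assume ab: "\<bar>a\<bar> \<le> d" "\<bar>b\<bar> \<le> d"
    define S where "S = \<bar>a\<bar> + \<bar>b\<bar>"
    have "\<bar>g (1 * a, 1 * b) - g (0, 0) - c1 * (1 * a) - c2 * (1 * b)\<bar> \<le> (K * S\<^sup>2) * \<bar>1\<bar>"
    proof (rule abs_le_of_deriv_bound[where
          f = "\<lambda>t. g (t * a, t * b) - g (0, 0) - c1 * (t * a) - c2 * (t * b)" and
          f' = "\<lambda>t. (a * g' (t * a, t * b) (1, 0) + b * g' (t * a, t * b) (0, 1)) - c1 * a - c2 * b"])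
      fix t :: real assume "\<bar>t\<bar> \<le> \<bar>1\<bar>"
      then have t: "\<bar>t\<bar> \<le> 1" by simp
      have tab: "\<bar>t * a\<bar> \<le> \<bar>a\<bar>" "\<bar>t * b\<bar> \<le> \<bar>b\<bar>"
        using t by (auto simp: abs_mult mult_left_le_one_le)
      then have tab': "\<bar>t * a\<bar> \<le> d" "\<bar>t * b\<bar> \<le> d" using ab by auto
      show "((\<lambda>t. g (t * a, t * b) - g (0, 0) - c1 * (t * a) - c2 * (t * b)) has_real_derivative
          (a * g' (t * a, t * b) (1, 0) + b * g' (t * a, t * b) (0, 1)) - c1 * a - c2 * b) (at t)"
        by (rule derivative_eq_intros has_derivative_ray g' inU tab' refl | simp)+
      have nS: "norm (t * a, t * b) \<le> S"
        using norm_Pair_le_sum[of "t * a" "t * b"] tab by (simp add: S_def)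
      have n0: "(t * a, t * b) - (0, 0) = (t * a, t * b)" by simp
      have "\<bar>g' (t * a, t * b) (1, 0) - c1\<bar> \<le> K1 * norm (t * a, t * b)"
        using K1(3)[of "(t * a, t * b)"] small[OF tab'] unfolding n0 c1_def by simp
      also have "\<dots> \<le> K1 * S" using nS K1(1) by (rule mult_left_mono)
      finally have b1: "\<bar>g' (t * a, t * b) (1, 0) - c1\<bar> \<le> K1 * S" .
      have "\<bar>g' (t * a, t * b) (0, 1) - c2\<bar> \<le> K2 * norm (t * a, t * b)"
        using K2(3)[of "(t * a, t * b)"] small[OF tab'] unfolding n0 c2_def by simp
      also have "\<dots> \<le> K2 * S" using nS K2(1) by (rule mult_left_mono)
      finally have b2: "\<bar>g' (t * a, t * b) (0, 1) - c2\<bar> \<le> K2 * S" .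
      have "\<bar>(a * g' (t * a, t * b) (1, 0) + b * g' (t * a, t * b) (0, 1)) - c1 * a - c2 * b\<bar>
          = \<bar>a * (g' (t * a, t * b) (1, 0) - c1) + b * (g' (t * a, t * b) (0, 1) - c2)\<bar>"
        by (simp add: algebra_simps)
      also have "\<dots> \<le> \<bar>a\<bar> * (K1 * S) + \<bar>b\<bar> * (K2 * S)"
        using b1 b2 by (intro order_trans[OF abs_triangle_ineq] add_mono) (auto simp: abs_mult intro!: mult_left_mono)
      also have "\<dots> \<le> S * (K1 * S) + S * (K2 * S)"
        using K1 K2 by (intro add_mono mult_right_mono) (auto simp: S_def)
      also have "\<dots> = K * S\<^sup>2" by (simp add: K_def power2_eq_square algebra_simps)
      finally show "\<bar>(a * g' (t * a, t * b) (1, 0) + b * g' (t * a, t * b) (0, 1)) - c1 * a - c2 * b\<bar> \<le> K * S\<^sup>2" .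
    qed simp
    moreover have "S\<^sup>2 \<le> 2 * (a\<^sup>2 + b\<^sup>2)"
      using sum_squares_bound[of "\<bar>a\<bar>" "\<bar>b\<bar>"] by (simp add: S_def power2_sum)
    then have "K * S\<^sup>2 \<le> 2 * K * (a\<^sup>2 + b\<^sup>2)"
      using K1(1) K2(1) mult_left_mono[of "S\<^sup>2" "2 * (a\<^sup>2 + b\<^sup>2)" K] by (simp add: K_def algebra_simps)
    ultimately show "(a, b) \<in> U \<and> \<bar>g (a, b) - g (0, 0) - c1 * a - c2 * b\<bar> \<le> 2 * K * (a\<^sup>2 + b\<^sup>2)"
      using inU[OF ab] by simp
  qed (use d K1 K2 in \<open>auto simp: K_def\<close>)
qed

text \<open>Because \<open>f\<close> vanishes on both axes, it is recovered by integrating its mixed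
  partial \<open>g\<close> from 0 in each variable. \<open>g\<close> is of class C^2, so its
  first-order expansion has error O(a^2 + b^2); the two integrations multiply every term by a and b,
  which yields the factor |a b| in the remainder and the halves in the cubic coefficients.\<close>

lemma C4_taylor_vanishing_on_axes:
  fixes f :: "real \<times> real \<Rightarrow> real"
  assumes "open U" "(0, 0) \<in> U" "Ck_on 4 U f"
    and axis1: "\<And>a. (a, 0) \<in> U \<Longrightarrow> f (a, 0) = 0" and axis2: "\<And>b. (0, b) \<in> U \<Longrightarrow> f (0, b) = 0"
  obtains h c1 c2 C d where "C \<ge> 0" "d > 0"
    "\<And>a b. \<bar>a\<bar> \<le> d \<Longrightarrow> \<bar>b\<bar> \<le> d \<Longrightarrow> (a, b) \<in> U \<and>
       \<bar>f (a, b) - h * (a * b) - c1 * (a\<^sup>2 * b) - c2 * (a * b\<^sup>2)\<bar> \<le> C * (\<bar>a\<bar> * \<bar>b\<bar> * (a\<^sup>2 + b\<^sup>2))"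
proof -
  obtain f' where f': "\<And>x. x \<in> U \<Longrightarrow> (f has_derivative f' x) (at x)"
    and fk: "\<And>v. Ck_on 3 U (\<lambda>x. f' x v)"
    using assms(3) by (auto simp: numeral_eq_Suc)
  define u where "u = (\<lambda>x. f' x (0, 1))"
  obtain u' where u': "\<And>x. x \<in> U \<Longrightarrow> (u has_derivative u' x) (at x)"
    and uk: "\<And>v. Ck_on 2 U (\<lambda>x. u' x v)"
    using fk[of "(0, 1)"] unfolding u_def[symmetric] by (auto simp: numeral_eq_Suc)
  define g where "g = (\<lambda>x. u' x (1, 0))"
  have "Ck_on 2 U g" unfolding g_def by (rule uk)
  then obtain c1 c2 C d where C: "C \<ge> 0" and d: "d > 0" and
    g: "\<And>a b. \<bar>a\<bar> \<le> d \<Longrightarrow> \<bar>b\<bar> \<le> d \<Longrightarrow>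
       (a, b) \<in> U \<and> \<bar>g (a, b) - g (0, 0) - c1 * a - c2 * b\<bar> \<le> C * (a\<^sup>2 + b\<^sup>2)"
    using C2_taylor_at_0[OF assms(1,2)] by metis
  \<comment> \<open>\<open>f\<close> is constantly 0 along this axis, so its partial
    \<open>u\<close> in the second variable vanishes there; this is the initial value for
    integrating \<open>g\<close> in the first variable.\<close>
  have u0: "u (0, b) = 0" if "\<bar>b\<bar> \<le> d" for b
  proof -
    have bU: "(0, b) \<in> U" using g[of 0 b] that d by simp
    have "((\<lambda>t. f (0, t)) has_real_derivative u (0, b)) (at b)"
      unfolding u_def by (rule has_derivative_snd_line[OF f'[OF bU]])
    then have "((\<lambda>t. 0) has_real_derivative u (0, b)) (at b)"
      by (rule has_field_derivative_transform_within_open[where S = "(\<lambda>t. (0, t)) -` U"])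
        (use assms(1) bU axis2 in \<open>auto intro!: continuous_open_vimage continuous_intros\<close>)
    moreover have "((\<lambda>t. 0) has_real_derivative 0) (at b)" by simp
    ultimately show ?thesis by (rule DERIV_unique)
  qed
  have ub: "\<bar>u (a, b) - g (0, 0) * a - c1 / 2 * a\<^sup>2 - c2 * b * a\<bar> \<le> C * (a\<^sup>2 + b\<^sup>2) * \<bar>a\<bar>"
    if ab: "\<bar>a\<bar> \<le> d" "\<bar>b\<bar> \<le> d" for a b
  proof (rule abs_le_of_deriv_bound[where f = "\<lambda>a. u (a, b) - g (0, 0) * a - c1 / 2 * a\<^sup>2 - c2 * b * a"
        and f' = "\<lambda>s. g (s, b) - g (0, 0) - c1 * s - c2 * b"])
    fix s assume s: "\<bar>s\<bar> \<le> \<bar>a\<bar>"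
    then have sU: "(s, b) \<in> U" using g[of s b] ab by simp
    have D: "((\<lambda>s. u (s, b)) has_real_derivative g (s, b)) (at s)"
      unfolding g_def by (rule has_derivative_fst_line[OF u'[OF sU]])
    show "((\<lambda>a. u (a, b) - g (0, 0) * a - c1 / 2 * a\<^sup>2 - c2 * b * a) has_real_derivative
        g (s, b) - g (0, 0) - c1 * s - c2 * b) (at s)"
      by (rule derivative_eq_intros D refl | simp)+
    have "s\<^sup>2 \<le> a\<^sup>2" using s by (simp add: abs_le_square_iff)
    then have "C * (s\<^sup>2 + b\<^sup>2) \<le> C * (a\<^sup>2 + b\<^sup>2)" using C by (simp add: mult_left_mono)
    then show "\<bar>g (s, b) - g (0, 0) - c1 * s - c2 * b\<bar> \<le> C * (a\<^sup>2 + b\<^sup>2)"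
      using g[of s b] s ab by simp
  qed (simp add: u0 that)
  show ?thesis
  proof (rule that[OF C d, of "g (0, 0)" "c1 / 2" "c2 / 2"])
    fix a b :: real assume ab: "\<bar>a\<bar> \<le> d" "\<bar>b\<bar> \<le> d"
    have "\<bar>f (a, b) - g (0, 0) * a * b - c1 / 2 * a\<^sup>2 * b - c2 / 2 * a * b\<^sup>2\<bar>
        \<le> C * (a\<^sup>2 + b\<^sup>2) * \<bar>a\<bar> * \<bar>b\<bar>"
    proof (rule abs_le_of_deriv_bound[where
          f = "\<lambda>b. f (a, b) - g (0, 0) * a * b - c1 / 2 * a\<^sup>2 * b - c2 / 2 * a * b\<^sup>2"
          and f' = "\<lambda>t. u (a, t) - g (0, 0) * a - c1 / 2 * a\<^sup>2 - c2 * t * a"])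
      show "f (a, 0) - g (0, 0) * a * 0 - c1 / 2 * a\<^sup>2 * 0 - c2 / 2 * a * 0\<^sup>2 = 0"
        using axis1 g[of a 0] ab d by simp
      fix t assume t: "\<bar>t\<bar> \<le> \<bar>b\<bar>"
      then have tU: "(a, t) \<in> U" using g[of a t] ab by simp
      have D: "((\<lambda>t. f (a, t)) has_real_derivative u (a, t)) (at t)"
        unfolding u_def by (rule has_derivative_snd_line[OF f'[OF tU]])
      show "((\<lambda>b. f (a, b) - g (0, 0) * a * b - c1 / 2 * a\<^sup>2 * b - c2 / 2 * a * b\<^sup>2) has_real_derivative
          u (a, t) - g (0, 0) * a - c1 / 2 * a\<^sup>2 - c2 * t * a) (at t)"
        by (rule derivative_eq_intros D refl | simp)+
      have "t\<^sup>2 \<le> b\<^sup>2" using t by (simp add: abs_le_square_iff)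
      then have "C * (a\<^sup>2 + t\<^sup>2) * \<bar>a\<bar> \<le> C * (a\<^sup>2 + b\<^sup>2) * \<bar>a\<bar>"
        using C by (simp add: mult_left_mono mult_right_mono)
      then show "\<bar>u (a, t) - g (0, 0) * a - c1 / 2 * a\<^sup>2 - c2 * t * a\<bar> \<le> C * (a\<^sup>2 + b\<^sup>2) * \<bar>a\<bar>"
        using ub[of a t] ab t by simp
    qed
    then show "(a, b) \<in> U \<and>
       \<bar>f (a, b) - g (0, 0) * (a * b) - c1 / 2 * (a\<^sup>2 * b) - c2 / 2 * (a * b\<^sup>2)\<bar>
         \<le> C * (\<bar>a\<bar> * \<bar>b\<bar> * (a\<^sup>2 + b\<^sup>2))"
      using g[OF ab] by (simp add: mult_ac)
  qed
qed

section \<open>Translation functions and Fisher information\<close>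

lemma exp_sub_one_sub_bound:
  fixes t :: real
  assumes "t \<le> 1"
  shows "\<bar>exp t - 1 - t\<bar> \<le> t\<^sup>2"
proof -
  have "exp t \<le> 1 + t + t\<^sup>2"
  proof (cases "t \<ge> 0")
    case True
    then show ?thesis using assms by (rule exp_bound)
  next
    case False
    have "exp t = 1 / exp (- t)" by (simp add: exp_minus field_simps)
    also have "\<dots> \<le> 1 / (1 - t)"
      using exp_ge_add_one_self[of "- t"] False by (intro divide_left_mono) auto
    also have "\<dots> \<le> 1 + t + t\<^sup>2"
    proof -
      have "t ^ 3 \<le> 0" using False by (simp add: power_le_zero_eq)
      moreover have "(1 + t + t\<^sup>2) * (1 - t) = 1 - t ^ 3"
        by (simp add: algebra_simps power2_eq_square power3_eq_cube)
      ultimately show ?thesis using False by (simp add: divide_le_eq)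
    qed
    finally show ?thesis .
  qed
  then show ?thesis using exp_ge_add_one_self[of t] zero_le_power2[of t] by linarith
qed

lemma nonvanishing_densityD:
  assumes "nonvanishing_density P p"
  shows "p \<in> borel_measurable borel" "\<And>w. p w > 0" "\<And>w. p w \<noteq> 0"
    "P = density lborel (\<lambda>w. ennreal (p w))" "sets P = sets borel" "space P = UNIV"
  using assms unfolding nonvanishing_density_def by (auto simp: less_imp_neq[symmetric])

text \<open>Translation invariance of Lebesgue measure, together with positivity of
  \<open>p\<close>, makes the ratio the density of the shifted law with respect to the original one.
  The translation integrand is a product of two such ratios.\<close>

lemma distr_shift_eq_density:
  assumes "nonvanishing_density P p"
  shows "distr P borel (\<lambda>z. z + a) = density P (\<lambda>z. ennreal (p (z - a) / p z))"
proof (rule measure_eqI)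
  note nv = nonvanishing_densityD[OF assms]
  note [measurable] = nv(1)
  have [measurable_cong]: "sets P = sets borel" by (rule nv(5))
  show "sets (distr P borel (\<lambda>z. z + a)) = sets (density P (\<lambda>z. ennreal (p (z - a) / p z)))"
    by (simp add: nv(5))
  fix S assume "S \<in> sets (distr P borel (\<lambda>z. z + a))"
  then have [measurable]: "S \<in> sets borel" by simp
  have "emeasure (distr P borel (\<lambda>z. z + a)) S = (\<integral>\<^sup>+z. indicator S z \<partial>distr P borel (\<lambda>z. z + a))"
    by simp
  also have "\<dots> = (\<integral>\<^sup>+z. indicator S (z + a) \<partial>P)" by (subst nn_integral_distr) auto
  also have "\<dots> = (\<integral>\<^sup>+z. ennreal (p z) * indicator S (z + a) \<partial>lborel)"
    unfolding nv(4) by (subst nn_integral_density) auto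
  also have "\<dots> = (\<integral>\<^sup>+z. ennreal (p (z - a)) * indicator S z \<partial>lborel)"
    by (subst nn_integral_real_affine[of _ 1 "- a"]) auto
  also have "\<dots> = (\<integral>\<^sup>+z. ennreal (p z) * (ennreal (p (z - a) / p z) * indicator S z) \<partial>lborel)"
    by (intro nn_integral_cong)
      (simp add: mult.assoc[symmetric] ennreal_mult'[symmetric] less_imp_le nv(2,3))
  also have "\<dots> = (\<integral>\<^sup>+z. ennreal (p (z - a) / p z) * indicator S z \<partial>P)"
    unfolding nv(4) by (subst nn_integral_density) auto
  also have "\<dots> = emeasure (density P (\<lambda>z. ennreal (p (z - a) / p z))) S"
    by (subst emeasure_density) (auto simp: nv(4))
  finally show "emeasure (distr P borel (\<lambda>z. z + a)) S
    = emeasure (density P (\<lambda>z. ennreal (p (z - a) / p z))) S" .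
qed

text \<open>The ratio is a probability density with respect to \<open>P\<close>. Mean 1 is what
  makes the translation function vanish on both axes.\<close>

lemma integral_shift_ratio:
  assumes "prob_space P" "nonvanishing_density P p"
  shows "integrable P (\<lambda>z. p (z - a) / p z)" "(\<integral>z. p (z - a) / p z \<partial>P) = 1"
proof -
  interpret prob_space P by fact
  note nv = nonvanishing_densityD[OF assms(2)]
  note [measurable] = nv(1)
  have [measurable_cong]: "sets P = sets borel" by (rule nv(5))
  have "(\<integral>\<^sup>+z. ennreal (p (z - a) / p z) \<partial>P) = emeasure (distr P borel (\<lambda>z. z + a)) UNIV"
    unfolding distr_shift_eq_density[OF assms(2)]
    by (subst emeasure_density) (auto simp: nv(5))
  also have "\<dots> = 1"
    using prob_space.emeasure_space_1[OF prob_space_distr[of "\<lambda>z. z + a" borel]] by simp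
  finally have "(\<integral>\<^sup>+z. ennreal (p (z - a) / p z) \<partial>P) = ennreal 1" by simp
  then have "integrable P (\<lambda>z. p (z - a) / p z) \<and> (\<integral>z. p (z - a) / p z \<partial>P) = 1"
    by (subst (asm) nn_integral_eq_integrable) (auto simp: nv(2) less_imp_le)
  then show "integrable P (\<lambda>z. p (z - a) / p z)" "(\<integral>z. p (z - a) / p z \<partial>P) = 1" by auto
qed

text \<open>The expectation must be strictly positive before \<open>ln\<close> can be
  undone.\<close>

lemma exp_translation_function:
  assumes "prob_space P" "nonvanishing_density P p" "integrable P (translation_integrand p ab)"
  shows "exp (translation_function P p ab) = (\<integral>z. translation_integrand p ab z \<partial>P)"
proof -
  interpret prob_space P by fact
  have "translation_integrand p ab z > 0" for z
    using nonvanishing_densityD(2)[OF assms(2)] by (simp add: translation_integrand_def)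
  then have "(\<integral>z. 0 \<partial>P) < (\<integral>z. translation_integrand p ab z \<partial>P)"
    using assms(3) by (intro integral_less_AE_space) (auto simp: emeasure_space_1)
  then show ?thesis by (simp add: translation_function_def)
qed

lemma translation_function_expansion:
  assumes "prob_space P" "nonvanishing_density P p" "translation_C4_near_0 P p"
  obtains h c1 c2 C d where "C \<ge> 0" "d > 0"
    "\<And>a b. \<bar>a\<bar> \<le> d \<Longrightarrow> \<bar>b\<bar> \<le> d \<Longrightarrow> integrable P (translation_integrand p (a, b)) \<and>
       \<bar>translation_function P p (a, b) - h * (a * b) - c1 * (a\<^sup>2 * b) - c2 * (a * b\<^sup>2)\<bar>
         \<le> C * (\<bar>a\<bar> * \<bar>b\<bar> * (a\<^sup>2 + b\<^sup>2))"
proof -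
  obtain U where U: "open U" "(0, 0) \<in> U" "\<And>ab. ab \<in> U \<Longrightarrow> integrable P (translation_integrand p ab)"
    "Ck_on 4 U (translation_function P p)"
    using assms(3) unfolding translation_C4_near_0_def by blast
  note nv = nonvanishing_densityD[OF assms(2)]
  have axes: "translation_function P p (a, 0) = 0" "translation_function P p (0, a) = 0" for a
    using integral_shift_ratio[OF assms(1,2)] nv(3)
    by (simp_all add: translation_function_def translation_integrand_def)
  show ?thesis
    by (rule C4_taylor_vanishing_on_axes[OF U(1,2,4) axes]) (use U(3) that in blast)
qed

text \<open>A substitute for the triangle inequality in L^2: the norm of y is changed by a factor
  close to 1, at the cost of a large multiple of the distance, which is harmless when the distance
  tends to 0.\<close>

lemma square_le_weighted:
  fixes x y :: real
  assumes "e > 0"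
  shows "x\<^sup>2 \<le> (1 + e) * y\<^sup>2 + (1 + 1 / e) * (x - y)\<^sup>2"
proof -
  define w where "w = x - y"
  have "0 \<le> (e * y - w)\<^sup>2 / e" using assms by simp
  also have "\<dots> = e * y\<^sup>2 - 2 * y * w + w\<^sup>2 / e"
    using assms by (simp add: field_simps power2_eq_square)
  finally have "2 * y * w \<le> e * y\<^sup>2 + w\<^sup>2 / e" by simp
  moreover have "x\<^sup>2 = y\<^sup>2 + 2 * y * w + w\<^sup>2" by (simp add: w_def power2_eq_square algebra_simps)
  ultimately show ?thesis using assms by (simp add: w_def[symmetric] algebra_simps)
qed

text \<open>
  The difference quotients \<open>D\<^sub>a z = (p (z - a) / p z - 1) / a\<close> have inner products
  \<open>(exp (\<tau> (a, b)) - 1) / (a * b) \<rightarrow> h\<close> in \<open>L\<^sup>2(P)\<close>, so they are Cauchy; by Fatou they converge in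
  \<open>L\<^sup>2(P)\<close> to \<open>- p' / p\<close>, whose squared norm is the Fisher information.
\<close>

lemma mixed_coefficient_le_fisher:
  assumes "prob_space P" "nonvanishing_density P p" "\<And>w. p differentiable (at w)"
    and "d > 0" "M \<ge> 0"
    and int: "\<And>a b. \<bar>a\<bar> \<le> d \<Longrightarrow> \<bar>b\<bar> \<le> d \<Longrightarrow> integrable P (translation_integrand p (a, b))"
    and exps: "\<And>a b. \<bar>a\<bar> \<le> d \<Longrightarrow> \<bar>b\<bar> \<le> d \<Longrightarrow>
       \<bar>translation_function P p (a, b) - h * (a * b)\<bar> \<le> M * (\<bar>a\<bar> * \<bar>b\<bar> * (\<bar>a\<bar> + \<bar>b\<bar>))"
  shows "h \<le> fisher_information P p"
proof -
  interpret prob_space P by fact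
  note nv = nonvanishing_densityD[OF assms(2)]
  note [measurable] = nv(1)
  have [measurable_cong]: "sets P = sets borel" by (rule nv(5))
  \<comment> \<open>\<open>L * (a * b)\<close> will bound |\<tau>| on the square of side
    \<open>e\<close>. The choice of \<open>e\<close> keeps arguments in the domain, makes a + b at
    most 2, and gives \<tau> \<le> 1, the range of the quadratic bound on
    \<open>exp\<close>.\<close>
  define L where "L = \<bar>h\<bar> + 2 * M"
  have L0: "L \<ge> 0" using assms(5) by (simp add: L_def)
  define e where "e = min (min d 1) (1 / (1 + L))"
  have e: "e > 0" "e \<le> d" "e \<le> 1" "L * e \<le> 1"
  proof -
    show "e > 0" "e \<le> d" "e \<le> 1" using assms(4) L0 by (auto simp: e_def)
    have "L * e \<le> L * (1 / (1 + L))" using L0 by (intro mult_left_mono) (auto simp: e_def)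
    also have "\<dots> \<le> 1" using L0 by (simp add: field_simps)
    finally show "L * e \<le> 1" .
  qed
  define N where "N = M + L\<^sup>2"
  have N0: "N \<ge> 0" using assms(5) by (simp add: N_def)
  define G where "G a b = (\<integral>z. translation_integrand p (a, b) z \<partial>P)" for a b
  \<comment> \<open>\<open>(G a b - 1) / (a * b)\<close> is the inner product of two difference
    quotients, as both ratios have mean 1. The error \<open>N\<close> has two sources:
    \<open>M\<close> from the expansion of \<tau>, and the square of \<open>L\<close> from replacing
    \<open>exp\<close> by its linear part.\<close>
  have G: "\<bar>(G a b - 1) / (a * b) - h\<bar> \<le> N * (a + b)"
    if ab: "0 < a" "a \<le> e" "0 < b" "b \<le> e" for a b
  proof -
    have abd: "\<bar>a\<bar> \<le> d" "\<bar>b\<bar> \<le> d" using ab e by auto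
    define t where "t = translation_function P p (a, b)"
    have Gt: "G a b = exp t"
      unfolding G_def t_def using exp_translation_function[OF assms(1,2) int[OF abd]] by simp
    have t1: "\<bar>t - h * (a * b)\<bar> \<le> M * (a * b * (a + b))"
      using exps[OF abd] ab by (simp add: t_def)
    have "M * (a * b * (a + b)) \<le> M * (a * b * 2)"
      using ab e assms(5) by (intro mult_left_mono) auto
    then have "\<bar>t\<bar> \<le> \<bar>h * (a * b)\<bar> + M * (a * b * 2)" using t1 by linarith
    also have "\<dots> = L * (a * b)" using ab by (simp add: L_def abs_mult algebra_simps)
    finally have t2: "\<bar>t\<bar> \<le> L * (a * b)" .
    have "a * b \<le> e * 1" using ab e by (intro mult_mono) auto
    then have "L * (a * b) \<le> L * e" using L0 by (simp add: mult_left_mono)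
    then have "t \<le> 1" using t2 e(4) by linarith
    then have "\<bar>exp t - 1 - t\<bar> \<le> t\<^sup>2" by (rule exp_sub_one_sub_bound)
    also have "t\<^sup>2 \<le> (L * (a * b))\<^sup>2" using t2 by (rule abs_le_square_iff[THEN iffD1, OF order_trans]) simp
    also have "\<dots> = L\<^sup>2 * (a * b * (a * b))" by (simp add: power2_eq_square algebra_simps)
    also have "\<dots> \<le> L\<^sup>2 * (a * b * (a + b))"
    proof -
      have "a * b \<le> a * 1" using ab e by (intro mult_left_mono) auto
      then have "a * b \<le> a + b" using ab by linarith
      then show ?thesis using ab by (intro mult_left_mono) auto
    qed
    finally have "\<bar>exp t - 1 - h * (a * b)\<bar> \<le> M * (a * b * (a + b)) + L\<^sup>2 * (a * b * (a + b))"
      using t1 by linarith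
    also have "\<dots> = N * (a * b * (a + b))" by (simp add: N_def distrib_right)
    finally have "\<bar>exp t - 1 - h * (a * b)\<bar> \<le> N * (a * b * (a + b))" .
    then have "\<bar>exp t - 1 - h * (a * b)\<bar> / (a * b) \<le> N * (a + b)"
      using ab by (simp add: divide_le_eq algebra_simps)
    moreover have "\<bar>exp t - 1 - h * (a * b)\<bar> / (a * b) = \<bar>(exp t - 1) / (a * b) - h\<bar>"
    proof -
      have "(exp t - 1) / (a * b) - h = (exp t - 1 - h * (a * b)) / (a * b)"
        using ab by (simp add: field_simps)
      then show ?thesis using ab by (simp add: abs_divide)
    qed
    ultimately show ?thesis by (simp add: Gt)
  qed
  define s where "s n = e / real (Suc n)" for n
  have s: "0 < s n" "s n \<le> e" for n using e by (auto simp: s_def divide_le_eq)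
  have s_mono: "s n \<le> s m" if "m \<le> n" for m n
    using e that by (auto simp: s_def intro!: divide_left_mono)
  have s_lim: "s \<longlonglongrightarrow> 0"
  proof -
    have "(\<lambda>n. e * (1 / real (Suc n))) \<longlonglongrightarrow> e * 0" by (intro tendsto_mult tendsto_const LIMSEQ_Suc[OF lim_1_over_n]) 
    then show ?thesis by (simp add: s_def[abs_def])
  qed
  define D where "D n z = (p (z - s n) / p z - 1) / s n" for n z
  define D0 where "D0 z = - deriv p z / p z" for z
  have D_meas [measurable]: "D n \<in> borel_measurable borel" for n unfolding D_def by measurable
  have D_lim: "(\<lambda>n. D n z) \<longlonglongrightarrow> D0 z" for z
  proof -
    have "(p has_real_derivative deriv p z) (at z)"
      using assms(3)[of z] DERIV_deriv_iff_real_differentiable by blast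
    then have "((\<lambda>h. (p (z + h) - p z) / h) \<longlongrightarrow> deriv p z) (at 0)" by (simp add: DERIV_def)
    moreover have "filterlim (\<lambda>n. - s n) (at 0) sequentially"
      using tendsto_minus[OF s_lim] s(1) by (auto simp: filterlim_at less_imp_neq[symmetric] intro!: always_eventually)
    ultimately have "(\<lambda>n. (p (z + - s n) - p z) / (- s n)) \<longlonglongrightarrow> deriv p z" by (rule filterlim_compose)
    then have "(\<lambda>n. - ((p (z + - s n) - p z) / (- s n)) / p z) \<longlonglongrightarrow> - deriv p z / p z"
      by (intro tendsto_intros) (use nv in auto)
    moreover have "- ((p (z + - s n) - p z) / (- s n)) / p z = D n z" for n
      using nv(3)[of z] s(1)[of n] by (simp add: D_def field_simps)
    ultimately show ?thesis by (simp add: D0_def)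
  qed
  \<comment> \<open>Measurability of the derivative is inherited from the difference
    quotients.\<close>
  have D0_meas [measurable]: "D0 \<in> borel_measurable borel"
    by (rule borel_measurable_LIMSEQ_real[OF D_lim]) simp
  have DD: "integrable P (\<lambda>z. D m z * D n z) \<and> \<bar>(\<integral>z. D m z * D n z \<partial>P) - h\<bar> \<le> N * (s m + s n)" for m n
  proof -
    let ?f = "\<lambda>n z. p (z - s n) / p z"
    have eq: "D m z * D n z = (translation_integrand p (s m, s n) z - ?f m z - ?f n z + 1) / (s m * s n)" for z
    proof -
      have "(x - 1) / c * ((y - 1) / d) = (x * y - x - y + 1) / (c * d)" for x y c d :: real
        by (simp only: times_divide_times_eq) (simp add: algebra_simps)
      then show ?thesis by (simp only: D_def translation_integrand_def fst_conv snd_conv)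
    qed
    have i: "integrable P (translation_integrand p (s m, s n))"
      using s[of m] s[of n] e by (intro int) auto
    note j = integral_shift_ratio[OF assms(1,2)]
    have "integrable P (\<lambda>z. D m z * D n z)" unfolding eq
      by (intro Bochner_Integration.integrable_divide Bochner_Integration.integrable_add Bochner_Integration.integrable_diff i j) auto
    moreover have "(\<integral>z. D m z * D n z \<partial>P) = (G (s m) (s n) - 1) / (s m * s n)"
      unfolding eq using i j by (simp add: G_def prob_space)
    ultimately show ?thesis using G[of "s m" "s n"] s by simp
  qed
  \<comment> \<open>When the square is expanded, the inner products contribute h - 2 h + h = 0. Only
    their errors remain, and since \<open>s\<close> decreases they are all charged to
    \<open>s m\<close>.\<close>
  have diff: "(\<integral>\<^sup>+z. ennreal ((D m z - D n z)\<^sup>2) \<partial>P) \<le> ennreal (8 * N * s m)" if "m \<le> n" for m n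
  proof -
    have eq: "(D m z - D n z)\<^sup>2 = D m z * D m z - 2 * (D m z * D n z) + D n z * D n z" for z
      by (simp add: power2_eq_square algebra_simps)
    have int: "integrable P (\<lambda>z. (D m z - D n z)\<^sup>2)" unfolding eq using DD by simp
    have "(\<integral>z. (D m z - D n z)\<^sup>2 \<partial>P)
        = (\<integral>z. D m z * D m z \<partial>P) - 2 * (\<integral>z. D m z * D n z \<partial>P) + (\<integral>z. D n z * D n z \<partial>P)"
      unfolding eq using DD by simp
    also have "\<dots> \<le> 4 * (N * (s m + s n))"
      using DD[of m m] DD[of m n] DD[of n n] by (simp add: algebra_simps abs_le_iff)
    also have "\<dots> \<le> 4 * (N * (s m + s m))"
      using s_mono[OF that] N0 by (intro mult_left_mono) auto
    finally have "(\<integral>z. (D m z - D n z)\<^sup>2 \<partial>P) \<le> 8 * N * s m" by simp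
    then show ?thesis by (subst nn_integral_eq_integral[OF int]) (auto intro: ennreal_leI)
  qed
  \<comment> \<open>Fatou in n at fixed m carries the Cauchy estimate over to the pointwise
    limit.\<close>
  have lim_diff: "(\<integral>\<^sup>+z. ennreal ((D m z - D0 z)\<^sup>2) \<partial>P) \<le> ennreal (8 * N * s m)" for m
  proof -
    have "(\<integral>\<^sup>+z. ennreal ((D m z - D0 z)\<^sup>2) \<partial>P) = (\<integral>\<^sup>+z. liminf (\<lambda>n. ennreal ((D m z - D n z)\<^sup>2)) \<partial>P)"
    proof (intro nn_integral_cong)
      fix z
      have "(\<lambda>n. ennreal ((D m z - D n z)\<^sup>2)) \<longlonglongrightarrow> ennreal ((D m z - D0 z)\<^sup>2)"
        by (intro tendsto_intros D_lim)
      then show "ennreal ((D m z - D0 z)\<^sup>2) = liminf (\<lambda>n. ennreal ((D m z - D n z)\<^sup>2))"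
        by (intro lim_imp_Liminf[symmetric]) simp_all
    qed
    also have "\<dots> \<le> liminf (\<lambda>n. \<integral>\<^sup>+z. ennreal ((D m z - D n z)\<^sup>2) \<partial>P)"
      by (rule nn_integral_liminf) simp
    also have "\<dots> \<le> liminf (\<lambda>n. ennreal (8 * N * s m))"
      by (rule Liminf_mono) (auto intro!: eventually_sequentiallyI[of m] diff)
    finally show ?thesis by (simp add: Liminf_const)
  qed
  have int_diff: "integrable P (\<lambda>z. (D m z - D0 z)\<^sup>2)" for m
    using lim_diff[of m] by (intro integrableI_bounded) (auto intro: le_less_trans)
  have diff_le: "(\<integral>z. (D m z - D0 z)\<^sup>2 \<partial>P) \<le> 8 * N * s m" for m
    using lim_diff[of m] N0 s(1)[of m]
    by (subst (asm) nn_integral_eq_integral[OF int_diff]) (auto simp: ennreal_le_iff)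
  have int_D2: "integrable P (\<lambda>z. (D m z)\<^sup>2)" for m using DD[of m m] by (simp add: power2_eq_square)
  \<comment> \<open>Without integrability the integral in \<open>fisher_information\<close> would
    take its default value 0, and the comparison would have no content.\<close>
  have int_D0: "integrable P (\<lambda>z. (D0 z)\<^sup>2)"
  proof (rule Bochner_Integration.integrable_bound)
    show "integrable P (\<lambda>z. 2 * (D 0 z)\<^sup>2 + 2 * (D 0 z - D0 z)\<^sup>2)" using int_D2 int_diff by simp
    have "(D0 z)\<^sup>2 \<le> 2 * (D 0 z)\<^sup>2 + 2 * (D 0 z - D0 z)\<^sup>2" for z
      using square_le_weighted[of 1 "D0 z" "D 0 z"] by (simp add: power2_commute)
    then show "AE z in P. norm ((D0 z)\<^sup>2) \<le> norm (2 * (D 0 z)\<^sup>2 + 2 * (D 0 z - D0 z)\<^sup>2)" by auto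
  qed simp
  have F: "fisher_information P p = (\<integral>z. (D0 z)\<^sup>2 \<partial>P)"
    by (simp add: fisher_information_def D0_def power_divide)
  \<comment> \<open>At fixed \<open>eps\<close> the index m tends to infinity, which kills the large
    factor \<open>1 + 1 / eps\<close>; only afterwards does \<open>eps\<close> tend to 0.\<close>
  have bnd: "h \<le> (1 + eps) * fisher_information P p" if "eps > 0" for eps
  proof (rule LIMSEQ_le_const)
    have "(\<lambda>m. (1 + eps) * fisher_information P p + (1 + 1 / eps) * (8 * N * s m) + 2 * N * s m)
       \<longlonglongrightarrow> (1 + eps) * fisher_information P p + (1 + 1 / eps) * (8 * N * 0) + 2 * N * 0"
      by (intro tendsto_intros s_lim)
    then show "(\<lambda>m. (1 + eps) * fisher_information P p + (1 + 1 / eps) * (8 * N * s m) + 2 * N * s m)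
       \<longlonglongrightarrow> (1 + eps) * fisher_information P p" by simp
    have "h \<le> (1 + eps) * fisher_information P p + (1 + 1 / eps) * (8 * N * s m) + 2 * N * s m" for m
    proof -
      have "(\<integral>z. (D m z)\<^sup>2 \<partial>P) \<le> (\<integral>z. (1 + eps) * (D0 z)\<^sup>2 + (1 + 1 / eps) * (D m z - D0 z)\<^sup>2 \<partial>P)"
        using int_D2 int_diff int_D0 square_le_weighted[OF that] by (intro integral_mono) auto
      also have "\<dots> = (1 + eps) * fisher_information P p + (1 + 1 / eps) * (\<integral>z. (D m z - D0 z)\<^sup>2 \<partial>P)"
        using int_diff int_D0 by (simp add: F)
      also have "\<dots> \<le> (1 + eps) * fisher_information P p + (1 + 1 / eps) * (8 * N * s m)"
        using diff_le[of m] that by (intro add_left_mono mult_left_mono) auto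
      finally have "(\<integral>z. (D m z)\<^sup>2 \<partial>P) \<le> (1 + eps) * fisher_information P p + (1 + 1 / eps) * (8 * N * s m)" .
      moreover have "\<bar>(\<integral>z. (D m z)\<^sup>2 \<partial>P) - h\<bar> \<le> 2 * N * s m"
        using DD[of m m] by (simp add: power2_eq_square algebra_simps)
      ultimately show ?thesis by linarith
    qed
    then show "\<exists>K. \<forall>m\<ge>K. h \<le> (1 + eps) * fisher_information P p + (1 + 1 / eps) * (8 * N * s m) + 2 * N * s m"
      by blast
  qed
  show ?thesis
  proof (rule LIMSEQ_le_const)
    have "(\<lambda>k. (1 + 1 / real (Suc k)) * fisher_information P p) \<longlonglongrightarrow> (1 + 0) * fisher_information P p"
      by (intro tendsto_intros LIMSEQ_Suc[OF lim_1_over_n])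
    then show "(\<lambda>k. (1 + 1 / real (Suc k)) * fisher_information P p) \<longlonglongrightarrow> fisher_information P p" by simp
    show "\<exists>K. \<forall>k\<ge>K. h \<le> (1 + 1 / real (Suc k)) * fisher_information P p"
      using bnd by auto
  qed
qed

section \<open>Delocalized spikes\<close>

text \<open>The scale is n^(1 - q/2), that of a vector whose entries all have order n^(-1/2), with
  one constant for the four exponents. The 8th powers control single entries, the 6th and 2nd the
  quartic remainder, the 4th the subgaussian width; the 4th and 8th also control the diagonals left
  over by symmetrisation.\<close>

definition delocalized :: "real \<Rightarrow> nat \<Rightarrow> (nat \<Rightarrow> real) \<Rightarrow> bool" where
  "delocalized K n x \<longleftrightarrow> (\<Sum>i<n. x i ^ 2) \<le> K \<and> (\<Sum>i<n. x i ^ 4) \<le> K / real n \<and>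
     (\<Sum>i<n. x i ^ 6) \<le> K / real n ^ 2 \<and> (\<Sum>i<n. x i ^ 8) \<le> K / real n ^ 3"

text \<open>This symmetrisation turns the sum over noise positions above the diagonal into the
  square of an inner product.\<close>

lemma sum_strict_upper_product:
  fixes u :: "nat \<Rightarrow> real"
  shows "(\<Sum>j<n. \<Sum>i<j. u i * u j) = ((\<Sum>i<n. u i)\<^sup>2 - (\<Sum>i<n. (u i)\<^sup>2)) / 2"
proof (induction n)
  case (Suc n)
  have "(\<Sum>i<n. u i * u n) = (\<Sum>i<n. u i) * u n" by (simp add: sum_distrib_right)
  with Suc show ?case by (simp add: power2_sum field_simps)
qed simp

text \<open>The sign of \<open>c\<close> is arbitrary, so the diagonal is charged with |c|, while
  the square keeps its exact factor \<open>c / 2\<close>.\<close>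

lemma sum_strict_upper_product_le:
  fixes u :: "nat \<Rightarrow> real"
  assumes "\<bar>c\<bar> * (\<Sum>i<n. (u i)\<^sup>2) \<le> B"
  shows "c * (\<Sum>j<n. \<Sum>i<j. u i * u j) \<le> c / 2 * (\<Sum>i<n. u i)\<^sup>2 + B"
proof -
  have "- c * (\<Sum>i<n. (u i)\<^sup>2) \<le> \<bar>c\<bar> * (\<Sum>i<n. (u i)\<^sup>2)"
    by (intro mult_right_mono sum_nonneg) auto
  moreover have "0 \<le> \<bar>c\<bar> * (\<Sum>i<n. (u i)\<^sup>2)" by (intro mult_nonneg_nonneg sum_nonneg) auto
  ultimately show ?thesis using assms
    unfolding sum_strict_upper_product by (simp add: field_simps)
qed

lemma delocalized_le:
  assumes "delocalized K n x" "i < n"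
  shows "x i ^ 8 \<le> K / real n ^ 3"
proof -
  have "x i ^ 8 \<le> (\<Sum>i<n. x i ^ 8)"
    using assms(2) by (intro member_le_sum) auto
  then show ?thesis using assms(1) by (simp add: delocalized_def)
qed

lemma delocalized_nonneg:
  assumes "delocalized K n x" shows "K \<ge> 0"
  using assms sum_nonneg[of "{..<n}" "\<lambda>i. x i ^ 2"] unfolding delocalized_def by auto

text \<open>The bound on 8th powers, used for both factors, makes the 8th power of the left side at
  most \<open>lam ^ 8 * K\<^sup>2\<close> / n^2. For large n all arguments of the translation
  functions therefore lie where the expansion is valid.\<close>

lemma delocalized_entry_bound:
  assumes "delocalized K n x" "i < n" "j < n" and "d > 0" and "lam ^ 8 * K\<^sup>2 \<le> d ^ 8 * (real n)\<^sup>2"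
  shows "\<bar>lam * sqrt (real n) * (x i * x j)\<bar> \<le> d"
proof -
  have n: "real n > 0" using assms(2) by simp
  have "sqrt (real n) ^ 8 = real n ^ 4"
    using n power_mult[of "sqrt (real n)" 2 4] by simp
  then have "\<bar>lam * sqrt (real n) * (x i * x j)\<bar> ^ 8 = lam ^ 8 * real n ^ 4 * (x i ^ 8 * x j ^ 8)"
    by (simp add: power_mult_distrib)
  also have "\<dots> \<le> lam ^ 8 * real n ^ 4 * (K / real n ^ 3 * (K / real n ^ 3))"
    using delocalized_le[OF assms(1,2)] delocalized_le[OF assms(1,3)] delocalized_nonneg[OF assms(1)]
    by (intro mult_left_mono mult_mono) auto
  also have "\<dots> = (lam ^ 8 * K\<^sup>2) / (real n)\<^sup>2"
    using n by (simp add: field_simps eval_nat_numeral)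
  also have "\<dots> \<le> d ^ 8" using n assms(5) by (simp add: divide_le_eq)
  finally have "\<bar>lam * sqrt (real n) * (x i * x j)\<bar> ^ Suc 7 \<le> d ^ Suc 7" by simp
  then show ?thesis by (rule power_le_imp_le_base) (use assms(4) in simp)
qed

lemma delocalized_square_square:
  assumes "delocalized K n x" "delocalized K n y"
  shows "real n * (\<Sum>i<n. (x i * y i)\<^sup>2) \<le> K"
proof (cases "n = 0")
  case False
  have "(x i * y i)\<^sup>2 \<le> (x i ^ 4 + y i ^ 4) / 2" for i
    using sum_squares_bound[of "(x i)\<^sup>2" "(y i)\<^sup>2"] by (simp add: power_mult_distrib)
  then have "(\<Sum>i<n. (x i * y i)\<^sup>2) \<le> (\<Sum>i<n. (x i ^ 4 + y i ^ 4) / 2)" by (intro sum_mono)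
  also have "\<dots> = ((\<Sum>i<n. x i ^ 4) + (\<Sum>i<n. y i ^ 4)) / 2"
    by (simp add: sum.distrib sum_divide_distrib add_divide_distrib)
  also have "\<dots> \<le> (K / real n + K / real n) / 2"
    using assms unfolding delocalized_def by (intro divide_right_mono add_mono) auto
  also have "\<dots> = K / real n" by simp
  finally show ?thesis using False by (simp add: field_simps)
qed (use delocalized_nonneg[OF assms(1)] in simp)

text \<open>AM-GM with weight n balances the two sides: n times the 8th powers and 1/n times the 4th
  powers both sum to at most K / n^2, which beats the prefactor n^(3/2).\<close>

lemma delocalized_fourth_square:
  assumes "delocalized K n x" "delocalized K n y"
  shows "real n * sqrt (real n) * (\<Sum>i<n. ((x i)\<^sup>2 * y i)\<^sup>2) \<le> K"
proof (cases "n = 0")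
  case False
  then have n: "real n \<ge> 1" by simp
  have "((x i)\<^sup>2 * y i)\<^sup>2 \<le> (real n * x i ^ 8 + y i ^ 4 / real n) / 2" for i
  proof -
    have "0 \<le> (real n * x i ^ 4 - (y i)\<^sup>2)\<^sup>2 / real n" by simp
    also have "\<dots> = real n * x i ^ 8 - 2 * (x i ^ 4 * (y i)\<^sup>2) + y i ^ 4 / real n"
      using n by (simp add: power2_diff field_simps eval_nat_numeral)
    finally show ?thesis by (simp add: power_mult_distrib)
  qed
  then have "(\<Sum>i<n. ((x i)\<^sup>2 * y i)\<^sup>2) \<le> (\<Sum>i<n. (real n * x i ^ 8 + y i ^ 4 / real n) / 2)"
    by (intro sum_mono)
  also have "\<dots> = (real n * (\<Sum>i<n. x i ^ 8) + (\<Sum>i<n. y i ^ 4) / real n) / 2"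
    by (simp add: sum.distrib sum_divide_distrib sum_distrib_left add_divide_distrib)
  also have "\<dots> \<le> (real n * (K / real n ^ 3) + (K / real n) / real n) / 2"
    using assms n by (intro divide_right_mono add_mono mult_left_mono) (auto simp: delocalized_def)
  also have "\<dots> = K / (real n)\<^sup>2" using n by (simp add: field_simps eval_nat_numeral)
  finally have *: "(\<Sum>i<n. ((x i)\<^sup>2 * y i)\<^sup>2) \<le> K / (real n)\<^sup>2" .
  have "sqrt (real n) \<le> real n"
    using n by (intro real_le_lsqrt) (auto simp: power2_eq_square)
  then have "real n * sqrt (real n) * (\<Sum>i<n. ((x i)\<^sup>2 * y i)\<^sup>2) \<le> real n * real n * (K / (real n)\<^sup>2)"
    using * n by (intro mult_mono sum_nonneg) auto
  also have "\<dots> = K" using n by (simp add: power2_eq_square)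
  finally show ?thesis .
qed (use delocalized_nonneg[OF assms(1)] in simp)

lemma delocalized_cube:
  assumes "delocalized K n x" "delocalized K n y"
  shows "(real n)\<^sup>2 * (\<Sum>i<n. \<bar>x i\<bar> ^ 3 * \<bar>y i\<bar>)\<^sup>2 \<le> K\<^sup>2"
proof (cases "n = 0")
  case False
  have "(\<Sum>i<n. \<bar>x i\<bar> ^ 3 * \<bar>y i\<bar>)\<^sup>2 \<le> (\<Sum>i<n. (\<bar>x i\<bar> ^ 3)\<^sup>2) * (\<Sum>i<n. \<bar>y i\<bar>\<^sup>2)"
    by (rule Cauchy_Schwarz_ineq_sum)
  also have "\<dots> = (\<Sum>i<n. x i ^ 6) * (\<Sum>i<n. (y i)\<^sup>2)" by (simp flip: power_mult)
  also have "\<dots> \<le> K / (real n)\<^sup>2 * K"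
    using assms delocalized_nonneg[OF assms(1)]
    by (intro mult_mono sum_nonneg) (auto simp: delocalized_def)
  finally show ?thesis using False by (simp add: field_simps power2_eq_square)
qed simp

text \<open>After symmetrisation only three quantities still depend on the pair of spikes: the
  overlap, and the inner product of each squared spike with the other one. Everything else is
  bounded uniformly over delocalized spikes.\<close>

lemma sum_translation_le:
  fixes \<tau> \<tau>d :: "real \<times> real \<Rightarrow> real"
  assumes x: "delocalized K n x" and y: "delocalized K n y"
    and "d > 0" "C \<ge> 0" "C' \<ge> 0" "lam \<ge> 0" and small: "lam ^ 8 * K\<^sup>2 \<le> d ^ 8 * (real n)\<^sup>2"
    and off: "\<And>a b. \<bar>a\<bar> \<le> d \<Longrightarrow> \<bar>b\<bar> \<le> d \<Longrightarrow>
       \<bar>\<tau> (a, b) - h * (a * b) - c1 * (a\<^sup>2 * b) - c2 * (a * b\<^sup>2)\<bar> \<le> C * (\<bar>a\<bar> * \<bar>b\<bar> * (a\<^sup>2 + b\<^sup>2))"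
    and diag: "\<And>a b. \<bar>a\<bar> \<le> d \<Longrightarrow> \<bar>b\<bar> \<le> d \<Longrightarrow> \<bar>\<tau>d (a, b)\<bar> \<le> C' * (\<bar>a\<bar> * \<bar>b\<bar>)"
  defines "s \<equiv> lam * sqrt (real n)"
  shows "(\<Sum>j<n. (\<Sum>i<j. \<tau> (s * (x i * x j), s * (y i * y j))) + \<tau>d (s * (x j * x j), s * (y j * y j)))
    \<le> h * lam\<^sup>2 * real n / 2 * (dot n x y)\<^sup>2
      + (\<bar>c1\<bar> + \<bar>c2\<bar>) * lam ^ 3 * (real n * sqrt (real n)) *
          ((dot n (\<lambda>i. (x i)\<^sup>2) y)\<^sup>2 + (dot n (\<lambda>i. (y i)\<^sup>2) x)\<^sup>2)
      + (\<bar>h\<bar> * lam\<^sup>2 * K + (\<bar>c1\<bar> + \<bar>c2\<bar>) * lam ^ 3 * K + 2 * C * lam ^ 4 * K\<^sup>2 + C' * lam\<^sup>2 * K)"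
proof -
  have s2: "s\<^sup>2 = lam\<^sup>2 * real n" by (simp add: s_def power_mult_distrib)
  have s3: "s ^ 3 = lam ^ 3 * (real n * sqrt (real n))"
    by (simp add: s_def power_mult_distrib power3_eq_cube)
  have s4: "s ^ 4 = lam ^ 4 * (real n)\<^sup>2"
    using power_mult[of s 2 2] by (simp add: s2 power_mult_distrib flip: power_mult)
  have s0: "s \<ge> 0" using assms(6) by (simp add: s_def)
  have K: "K \<ge> 0" by (rule delocalized_nonneg[OF x])
  define S where "S u = (\<Sum>j<n. \<Sum>i<j. u i * u j)" for u :: "nat \<Rightarrow> real"
  let ?xy = "\<lambda>i. x i * y i" and ?xxy = "\<lambda>i. (x i)\<^sup>2 * y i" and ?yyx = "\<lambda>i. (y i)\<^sup>2 * x i"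
  let ?x3y = "\<lambda>i. \<bar>x i\<bar> ^ 3 * \<bar>y i\<bar>" and ?y3x = "\<lambda>i. \<bar>y i\<bar> ^ 3 * \<bar>x i\<bar>"
  have "(\<Sum>j<n. \<Sum>i<j. \<tau> (s * (x i * x j), s * (y i * y j))) \<le>
    (\<Sum>j<n. \<Sum>i<j. (h * s\<^sup>2) * (?xy i * ?xy j) + (c1 * s ^ 3) * (?xxy i * ?xxy j)
      + (c2 * s ^ 3) * (?yyx i * ?yyx j) + (C * s ^ 4) * (?x3y i * ?x3y j) + (C * s ^ 4) * (?y3x i * ?y3x j))"
  proof (intro sum_mono)
    fix j i assume "j \<in> {..<n}" "i \<in> {..<j}"
    then have ij: "i < n" "j < n" by auto
    let ?a = "s * (x i * x j)" and ?b = "s * (y i * y j)"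
    have ab: "\<bar>?a\<bar> \<le> d" "\<bar>?b\<bar> \<le> d"
      using delocalized_entry_bound[OF x ij assms(3) small] delocalized_entry_bound[OF y ij assms(3) small]
      by (simp_all add: s_def)
    \<comment> \<open>The remainder splits into |a|^3 |b| + |a| |b|^3, and each summand again
      factors into a function of i times the same function of j.\<close>
    have "\<bar>?a\<bar> * \<bar>?b\<bar> * (?a\<^sup>2 + ?b\<^sup>2) = \<bar>?a\<bar> ^ 3 * \<bar>?b\<bar> + \<bar>?a\<bar> * \<bar>?b\<bar> ^ 3"
      by (simp add: power2_eq_square power3_eq_cube algebra_simps flip: abs_mult)
    also have "\<dots> = s ^ 4 * (?x3y i * ?x3y j) + s ^ 4 * (?y3x i * ?y3x j)"
      using s0 by (simp add: abs_mult power_mult_distrib eval_nat_numeral mult_ac)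
    finally have rem: "C * (\<bar>?a\<bar> * \<bar>?b\<bar> * (?a\<^sup>2 + ?b\<^sup>2))
      = (C * s ^ 4) * (?x3y i * ?x3y j) + (C * s ^ 4) * (?y3x i * ?y3x j)"
      by (simp add: algebra_simps)
    have "\<tau> (?a, ?b) \<le> h * (?a * ?b) + c1 * (?a\<^sup>2 * ?b) + c2 * (?a * ?b\<^sup>2) + C * (\<bar>?a\<bar> * \<bar>?b\<bar> * (?a\<^sup>2 + ?b\<^sup>2))"
      using off[OF ab] by linarith
    also have "h * (?a * ?b) + c1 * (?a\<^sup>2 * ?b) + c2 * (?a * ?b\<^sup>2)
      = (h * s\<^sup>2) * (?xy i * ?xy j) + (c1 * s ^ 3) * (?xxy i * ?xxy j) + (c2 * s ^ 3) * (?yyx i * ?yyx j)"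
      by (simp add: power2_eq_square power3_eq_cube mult_ac)
    finally show "\<tau> (?a, ?b) \<le> (h * s\<^sup>2) * (?xy i * ?xy j) + (c1 * s ^ 3) * (?xxy i * ?xxy j)
      + (c2 * s ^ 3) * (?yyx i * ?yyx j) + (C * s ^ 4) * (?x3y i * ?x3y j) + (C * s ^ 4) * (?y3x i * ?y3x j)"
      unfolding rem by linarith
  qed
  also have "\<dots> = (h * s\<^sup>2) * S ?xy + (c1 * s ^ 3) * S ?xxy + (c2 * s ^ 3) * S ?yyx
      + (C * s ^ 4) * S ?x3y + (C * s ^ 4) * S ?y3x"
    unfolding S_def by (simp only: sum.distrib flip: sum_distrib_left)
  finally have main: "(\<Sum>j<n. \<Sum>i<j. \<tau> (s * (x i * x j), s * (y i * y j))) \<le>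
      (h * s\<^sup>2) * S ?xy + (c1 * s ^ 3) * S ?xxy + (c2 * s ^ 3) * S ?yyx
      + (C * s ^ 4) * S ?x3y + (C * s ^ 4) * S ?y3x" .
  \<comment> \<open>Here the factor 1/2 must survive exactly, since it matches the exponent in
    \<open>lambda_star\<close>. In the cubic terms below it is given away.\<close>
  have b1: "(h * s\<^sup>2) * S ?xy \<le> h * lam\<^sup>2 * real n / 2 * (dot n x y)\<^sup>2 + \<bar>h\<bar> * lam\<^sup>2 * K"
  proof -
    have "\<bar>h * s\<^sup>2\<bar> * (\<Sum>i<n. (?xy i)\<^sup>2) = \<bar>h\<bar> * lam\<^sup>2 * (real n * (\<Sum>i<n. (?xy i)\<^sup>2))"
      by (simp add: s2 abs_mult)
    also have "\<dots> \<le> \<bar>h\<bar> * lam\<^sup>2 * K"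
      by (intro mult_left_mono delocalized_square_square[OF x y]) simp
    finally show ?thesis unfolding S_def dot_def
      by (intro order_trans[OF sum_strict_upper_product_le]) (auto simp: s2 mult_ac)
  qed
  have cubic: "(c * s ^ 3) * S (\<lambda>i. (u i)\<^sup>2 * v i) \<le>
      \<bar>c\<bar> * lam ^ 3 * (real n * sqrt (real n)) * (dot n (\<lambda>i. (u i)\<^sup>2) v)\<^sup>2 + \<bar>c\<bar> * lam ^ 3 * K"
    if uv: "delocalized K n u" "delocalized K n v" for c u v
  proof -
    have "\<bar>c * s ^ 3\<bar> * (\<Sum>i<n. ((u i)\<^sup>2 * v i)\<^sup>2)
      = \<bar>c\<bar> * lam ^ 3 * (real n * sqrt (real n) * (\<Sum>i<n. ((u i)\<^sup>2 * v i)\<^sup>2))"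
      using assms(6) by (simp add: s3 abs_mult)
    also have "\<dots> \<le> \<bar>c\<bar> * lam ^ 3 * K"
      using assms(6) by (intro mult_left_mono delocalized_fourth_square[OF uv]) simp
    finally have "(c * s ^ 3) * S (\<lambda>i. (u i)\<^sup>2 * v i)
      \<le> c * s ^ 3 / 2 * (dot n (\<lambda>i. (u i)\<^sup>2) v)\<^sup>2 + \<bar>c\<bar> * lam ^ 3 * K"
      unfolding S_def dot_def by (rule sum_strict_upper_product_le)
    also have "c * s ^ 3 / 2 \<le> \<bar>c\<bar> * s ^ 3"
    proof -
      have "c / 2 \<le> \<bar>c\<bar>" by simp
      then have "c / 2 * s ^ 3 \<le> \<bar>c\<bar> * s ^ 3" using s0 by (intro mult_right_mono) auto
      then show ?thesis by simp
    qed
    then have "c * s ^ 3 / 2 * (dot n (\<lambda>i. (u i)\<^sup>2) v)\<^sup>2 + \<bar>c\<bar> * lam ^ 3 * K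
      \<le> \<bar>c\<bar> * s ^ 3 * (dot n (\<lambda>i. (u i)\<^sup>2) v)\<^sup>2 + \<bar>c\<bar> * lam ^ 3 * K"
      by (intro add_right_mono mult_right_mono) auto
    finally show ?thesis by (simp add: s3 mult_ac)
  qed
  have quart: "(C * s ^ 4) * S (\<lambda>i. \<bar>u i\<bar> ^ 3 * \<bar>v i\<bar>) \<le> C * lam ^ 4 * K\<^sup>2"
    if uv: "delocalized K n u" "delocalized K n v" for u v
  proof -
    have "0 \<le> (\<Sum>i<n. (\<bar>u i\<bar> ^ 3 * \<bar>v i\<bar>)\<^sup>2)" by (intro sum_nonneg) simp
    then have "S (\<lambda>i. \<bar>u i\<bar> ^ 3 * \<bar>v i\<bar>) \<le> (\<Sum>i<n. \<bar>u i\<bar> ^ 3 * \<bar>v i\<bar>)\<^sup>2"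
      using zero_le_power2[of "\<Sum>i<n. \<bar>u i\<bar> ^ 3 * \<bar>v i\<bar>"]
      unfolding S_def sum_strict_upper_product by (simp add: field_simps)
    then have "(C * s ^ 4) * S (\<lambda>i. \<bar>u i\<bar> ^ 3 * \<bar>v i\<bar>) \<le> (C * s ^ 4) * (\<Sum>i<n. \<bar>u i\<bar> ^ 3 * \<bar>v i\<bar>)\<^sup>2"
      using assms(4) by (intro mult_left_mono) auto
    also have "\<dots> = C * lam ^ 4 * ((real n)\<^sup>2 * (\<Sum>i<n. \<bar>u i\<bar> ^ 3 * \<bar>v i\<bar>)\<^sup>2)" by (simp add: s4)
    also have "\<dots> \<le> C * lam ^ 4 * K\<^sup>2"
      using assms(4) by (intro mult_left_mono delocalized_cube[OF uv]) auto
    finally show ?thesis .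
  qed
  have "(\<Sum>j<n. \<tau>d (s * (x j * x j), s * (y j * y j))) \<le> (\<Sum>j<n. C' * s\<^sup>2 * (?xy j)\<^sup>2)"
  proof (intro sum_mono)
    fix j assume "j \<in> {..<n}"
    then have j: "j < n" by simp
    have ab: "\<bar>s * (x j * x j)\<bar> \<le> d" "\<bar>s * (y j * y j)\<bar> \<le> d"
      using delocalized_entry_bound[OF x j j assms(3) small] delocalized_entry_bound[OF y j j assms(3) small]
      by (simp_all add: s_def)
    have "\<tau>d (s * (x j * x j), s * (y j * y j)) \<le> C' * (\<bar>s * (x j * x j)\<bar> * \<bar>s * (y j * y j)\<bar>)"
      using diag[OF ab] by linarith
    also have "\<dots> = C' * s\<^sup>2 * (?xy j)\<^sup>2"
      using s0 by (simp add: abs_mult power2_eq_square mult_ac)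
    finally show "\<tau>d (s * (x j * x j), s * (y j * y j)) \<le> C' * s\<^sup>2 * (?xy j)\<^sup>2" .
  qed
  also have "\<dots> = C' * lam\<^sup>2 * (real n * (\<Sum>j<n. (?xy j)\<^sup>2))" by (simp add: s2 sum_distrib_left mult_ac)
  also have "\<dots> \<le> C' * lam\<^sup>2 * K"
    using assms(5) by (intro mult_left_mono delocalized_square_square[OF x y]) simp
  finally have diag': "(\<Sum>j<n. \<tau>d (s * (x j * x j), s * (y j * y j))) \<le> C' * lam\<^sup>2 * K" .
  let ?N = "real n * sqrt (real n)"
  have widen: "\<bar>c1\<bar> * lam ^ 3 * ?N * A + \<bar>c2\<bar> * lam ^ 3 * ?N * B
      \<le> (\<bar>c1\<bar> + \<bar>c2\<bar>) * lam ^ 3 * ?N * (A + B)" if "A \<ge> 0" "B \<ge> 0" for A B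
  proof -
    have "0 \<le> \<bar>c1\<bar> * lam ^ 3 * ?N * B" "0 \<le> \<bar>c2\<bar> * lam ^ 3 * ?N * A"
      using that assms(6) by simp_all
    then show ?thesis by (simp add: algebra_simps)
  qed
  show ?thesis
    using main b1 cubic[OF x y, of c1] cubic[OF y x, of c2] quart[OF x y] quart[OF y x] diag'
      widen[of "(dot n (\<lambda>i. (x i)\<^sup>2) y)\<^sup>2" "(dot n (\<lambda>i. (y i)\<^sup>2) x)\<^sup>2"]
    unfolding sum.distrib by (simp add: distrib_right)
qed

section \<open>Subgaussian squares, shifts of product measures, second moments\<close>

lemma nn_integral_normal_density:
  "0 < s \<Longrightarrow> (\<integral>\<^sup>+z. ennreal (normal_density m s z) \<partial>lborel) = 1"
  using prob_space.emeasure_space_1[OF prob_space_normal_density, of s m]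
  by (simp add: emeasure_density)

lemma nn_integral_exp_linear_normal:
  "(\<integral>\<^sup>+z. ennreal (exp (z * y) * normal_density 0 1 z) \<partial>lborel) = ennreal (exp (y\<^sup>2 / 2))"
proof -
  have "exp (z * y) * normal_density 0 1 z = exp (y\<^sup>2 / 2) * normal_density y 1 z" for z
    by (simp add: normal_density_def flip: exp_add)
      (simp add: power2_eq_square field_simps)
  then show ?thesis
    by (simp add: ennreal_mult' nn_integral_cmult nn_integral_normal_density)
qed

lemma nn_integral_exp_square_normal:
  "(\<integral>\<^sup>+z. ennreal (exp (z\<^sup>2 / 4) * normal_density 0 1 z) \<partial>lborel) = ennreal (sqrt 2)"
proof -
  have "exp (z\<^sup>2 / 4) * normal_density 0 1 z = sqrt 2 * normal_density 0 (sqrt 2) z" for z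
    by (simp add: normal_density_def real_sqrt_mult flip: exp_add) (simp add: field_simps)
  then show ?thesis
    by (simp add: ennreal_mult' nn_integral_cmult nn_integral_normal_density)
qed

lemma dot_measurable [measurable]:
  assumes "f \<in> measurable M (vec_space n)" "g \<in> measurable M (vec_space n)"
  shows "(\<lambda>w. dot n (f w) (g w)) \<in> borel_measurable M"
  unfolding dot_def using assms
  by (intro borel_measurable_sum borel_measurable_times)
    (auto intro: measurable_compose[OF _ measurable_component_singleton])

lemma dot_const_measurable [measurable]:
  "dot n v \<in> borel_measurable (vec_space n)"
  unfolding dot_def[abs_def]
  by (intro borel_measurable_sum borel_measurable_times) auto

text \<open>
  Linearisation of the square: \<open>exp (t * g\<^sup>2)\<close> is the moment generating function of a standard
  Gaussian \<open>z\<close> at \<open>sqrt (2 * t) * g\<close>, so the subgaussian bound applies for each fixed \<open>z\<close>.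
\<close>

lemma subgaussian_exp_square:
  assumes "subgaussian n s M" "prob_space M" and sets [measurable_cong]: "sets M = sets (vec_space n)"
    and "t \<ge> 0" "s * t * (\<Sum>i<n. (v i)\<^sup>2) \<le> 1 / 4"
  shows "(\<integral>\<^sup>+x. ennreal (exp (t * (dot n v x)\<^sup>2)) \<partial>M) \<le> ennreal (sqrt 2)"
proof -
  interpret prob_space M by fact
  interpret pair_sigma_finite M "lborel :: real measure" ..
  have L2: "(L2_set u {..<n})\<^sup>2 = (\<Sum>i<n. (u i)\<^sup>2)" for u
    unfolding L2_set_def by (intro real_sqrt_pow2 sum_nonneg) simp
  \<comment> \<open>The bound 1/4 stays below the 1/2 in the Gaussian weight, so integrating over z
    afterwards still converges; the result is a centred Gaussian of variance 2, whence the constant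
    \<open>sqrt 2\<close>.\<close>
  have sub: "(\<integral>\<^sup>+x. ennreal (exp (z * (sqrt (2 * t) * dot n v x))) \<partial>M) \<le> ennreal (exp (z\<^sup>2 / 4))" for z
  proof -
    define u where "u = (\<lambda>i. z * sqrt (2 * t) * v i)"
    have "dot n u x = z * (sqrt (2 * t) * dot n v x)" for x
      by (simp add: u_def dot_def sum_distrib_left mult_ac)
    moreover have "(\<integral>\<^sup>+x. ennreal (exp (dot n u x)) \<partial>M) \<le> ennreal (exp (s * (L2_set u {..<n})\<^sup>2 / 2))"
      using assms(1) unfolding subgaussian_def by blast
    ultimately have "(\<integral>\<^sup>+x. ennreal (exp (z * (sqrt (2 * t) * dot n v x))) \<partial>M)
        \<le> ennreal (exp (s * (\<Sum>i<n. (u i)\<^sup>2) / 2))"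
      by (simp add: L2)
    also have "s * (\<Sum>i<n. (u i)\<^sup>2) / 2 = z\<^sup>2 * (s * t * (\<Sum>i<n. (v i)\<^sup>2))"
      using assms(4) by (simp add: u_def power_mult_distrib flip: sum_distrib_left)
    also have "\<dots> \<le> z\<^sup>2 * (1 / 4)" using assms(5) by (intro mult_left_mono) auto
    finally show ?thesis by (simp add: ennreal_leI)
  qed
  have "(\<integral>\<^sup>+x. ennreal (exp (t * (dot n v x)\<^sup>2)) \<partial>M)
    = (\<integral>\<^sup>+x. (\<integral>\<^sup>+z. ennreal (exp (z * (sqrt (2 * t) * dot n v x)) * normal_density 0 1 z) \<partial>lborel) \<partial>M)"
    unfolding nn_integral_exp_linear_normal using assms(4) by (simp add: power_mult_distrib)
  also have "\<dots> = (\<integral>\<^sup>+z. (\<integral>\<^sup>+x. ennreal (exp (z * (sqrt (2 * t) * dot n v x)) * normal_density 0 1 z) \<partial>M) \<partial>lborel)"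
    by (rule Fubini'[symmetric]) measurable
  also have "\<dots> = (\<integral>\<^sup>+z. (\<integral>\<^sup>+x. ennreal (exp (z * (sqrt (2 * t) * dot n v x))) \<partial>M) * ennreal (normal_density 0 1 z) \<partial>lborel)"
    by (intro nn_integral_cong) (simp add: ennreal_mult nn_integral_multc)
  also have "\<dots> \<le> (\<integral>\<^sup>+z. ennreal (exp (z\<^sup>2 / 4)) * ennreal (normal_density 0 1 z) \<partial>lborel)"
    by (intro nn_integral_mono mult_right_mono sub) simp
  also have "\<dots> = ennreal (sqrt 2)"
    using nn_integral_exp_square_normal by (simp add: ennreal_mult)
  finally show ?thesis .
qed

section \<open>Change of measure for product noise\<close>

lemma product_sigma_finite_prob:
  "(\<And>i. prob_space (M i)) \<Longrightarrow> product_sigma_finite M"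
  unfolding product_sigma_finite_def by (auto intro: prob_space_imp_sigma_finite)

text \<open>Both sides are identified with the product \<open>PiM I N\<close> of the shifted
  factors, by uniqueness of a product measure with given values on boxes.\<close>

lemma distr_PiM_shift_eq_density:
  assumes "finite I" and prob: "\<And>i. prob_space (M i)"
    and nv: "\<And>i. nonvanishing_density (M i) (q i)"
  shows "distr (PiM I M) (PiM I (\<lambda>_. borel)) (\<lambda>w. \<lambda>i\<in>I. w i + a i)
    = density (PiM I M) (\<lambda>w. \<Prod>i\<in>I. ennreal (q i (w i - a i) / q i (w i)))" (is "?D = ?E")
proof -
  note nvD = nonvanishing_densityD[OF nv]
  note [measurable] = nvD(1)
  have sb [measurable_cong]: "sets (M i) = sets borel" for i by (rule nvD(5))
  have sM [measurable_cong]: "sets (PiM I M) = sets (PiM I (\<lambda>_. borel :: real measure))"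
    by (intro sets_PiM_cong) (auto simp: sb)
  have spM: "space (PiM I M) = (\<Pi>\<^sub>E i\<in>I. UNIV)" by (simp add: space_PiM nvD(6))
  define N where "N i = density (M i) (\<lambda>z. ennreal (q i (z - a i) / q i z))" for i
  have N: "N i = distr (M i) borel (\<lambda>z. z + a i)" for i
    unfolding N_def by (rule distr_shift_eq_density[OF nv, symmetric])
  have probN: "prob_space (N i)" for i
    unfolding N by (rule prob_space.prob_space_distr[OF prob]) simp
  have sN: "sets (N i) = sets borel" for i by (simp add: N)
  have sPN: "sets (PiM I N) = sets (PiM I (\<lambda>_. borel :: real measure))"
    by (intro sets_PiM_cong) (auto simp: sN)
  interpret M: product_sigma_finite M using prob by (rule product_sigma_finite_prob)
  interpret N: product_sigma_finite N using probN by (rule product_sigma_finite_prob)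
  have "?D = PiM I N"
  proof (rule N.PiM_eqI[OF assms(1)])
    show "sets ?D = sets (PiM I N)" by (simp add: sPN)
    fix A assume "\<And>i. i \<in> I \<Longrightarrow> A i \<in> sets (N i)"
    then have A: "A i \<in> sets borel" if "i \<in> I" for i using that by (simp add: sN)
    have pre: "(\<lambda>z. z + a i) -` A i \<in> sets borel" if "i \<in> I" for i
      using measurable_sets[OF _ A[OF that], of "\<lambda>z. z + a i" borel] by simp
    have "emeasure ?D (Pi\<^sub>E I A)
      = emeasure (PiM I M) ((\<lambda>w. \<lambda>i\<in>I. w i + a i) -` (Pi\<^sub>E I A) \<inter> space (PiM I M))"
      using A assms(1) by (intro emeasure_distr sets_PiM_I_finite) auto
    also have "(\<lambda>w. \<lambda>i\<in>I. w i + a i) -` (Pi\<^sub>E I A) \<inter> space (PiM I M) = Pi\<^sub>E I (\<lambda>i. (\<lambda>z. z + a i) -` A i)"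
      unfolding spM by (auto simp: PiE_iff)
    also have "emeasure (PiM I M) \<dots> = (\<Prod>i\<in>I. emeasure (M i) ((\<lambda>z. z + a i) -` A i))"
      using pre assms(1) by (intro M.emeasure_PiM) (auto simp: sb)
    also have "\<dots> = (\<Prod>i\<in>I. emeasure (N i) (A i))"
      using A by (intro prod.cong refl) (simp add: N emeasure_distr nvD(6))
    finally show "emeasure ?D (Pi\<^sub>E I A) = (\<Prod>i\<in>I. emeasure (N i) (A i))" .
  qed
  moreover have "?E = PiM I N"
  proof (rule N.PiM_eqI[OF assms(1)])
    show "sets ?E = sets (PiM I N)" by (simp add: sPN sM)
    fix A assume "\<And>i. i \<in> I \<Longrightarrow> A i \<in> sets (N i)"
    then have A [measurable]: "A i \<in> sets borel" if "i \<in> I" for i using that by (simp add: sN)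
    have PA: "Pi\<^sub>E I A \<in> sets (PiM I M)" using A assms(1) by (intro sets_PiM_I_finite) (auto simp: sb)
    have "emeasure ?E (Pi\<^sub>E I A)
      = (\<integral>\<^sup>+w. (\<Prod>i\<in>I. ennreal (q i (w i - a i) / q i (w i))) * indicator (Pi\<^sub>E I A) w \<partial>PiM I M)"
      by (rule emeasure_density[OF _ PA]) measurable
    also have "\<dots> = (\<integral>\<^sup>+w. (\<Prod>i\<in>I. ennreal (q i (w i - a i) / q i (w i)) * indicator (A i) (w i)) \<partial>PiM I M)"
    proof (intro nn_integral_cong)
      fix w assume w: "w \<in> space (PiM I M)"
      have "indicator (Pi\<^sub>E I A) w = (\<Prod>i\<in>I. indicator (A i) (w i) :: ennreal)"
      proof (cases "w \<in> Pi\<^sub>E I A")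
        case False
        then obtain i where "i \<in> I" "w i \<notin> A i" using w unfolding spM by (auto simp: PiE_iff)
        then have "(\<Prod>i\<in>I. indicator (A i) (w i) :: ennreal) = 0"
          by (intro prod_zero[OF assms(1)] bexI[of _ i]) auto
        then show ?thesis using False by simp
      qed (auto intro!: prod.neutral dest: PiE_mem)
      then show "(\<Prod>i\<in>I. ennreal (q i (w i - a i) / q i (w i))) * indicator (Pi\<^sub>E I A) w
        = (\<Prod>i\<in>I. ennreal (q i (w i - a i) / q i (w i)) * indicator (A i) (w i))"
        by (simp add: prod.distrib)
    qed
    also have "\<dots> = (\<Prod>i\<in>I. \<integral>\<^sup>+z. ennreal (q i (z - a i) / q i z) * indicator (A i) z \<partial>M i)"
      using assms(1) by (intro M.product_nn_integral_prod) measurable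
    also have "\<dots> = (\<Prod>i\<in>I. emeasure (N i) (A i))"
      using A unfolding N_def by (intro prod.cong refl emeasure_density[symmetric]) (auto simp: sb)
    finally show "emeasure ?E (Pi\<^sub>E I A) = (\<Prod>i\<in>I. emeasure (N i) (A i))" .
  qed
  ultimately show ?thesis by simp
qed

lemma nn_integral_likelihood_product:
  assumes "finite I" and prob: "\<And>i. prob_space (M i)"
    and nv: "\<And>i. nonvanishing_density (M i) (q i)"
    and int: "\<And>i. i \<in> I \<Longrightarrow> integrable (M i) (translation_integrand (q i) (a i, b i))"
  shows "(\<integral>\<^sup>+w. (\<Prod>i\<in>I. ennreal (q i (w i - a i) / q i (w i))) * (\<Prod>i\<in>I. ennreal (q i (w i - b i) / q i (w i))) \<partial>PiM I M)
    = ennreal (exp (\<Sum>i\<in>I. translation_function (M i) (q i) (a i, b i)))"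
proof -
  note nvD = nonvanishing_densityD[OF nv]
  interpret M: product_sigma_finite M using prob by (rule product_sigma_finite_prob)
  have pos: "translation_integrand (q i) ab z \<ge> 0" for i ab z
    using nvD(2) by (simp add: translation_integrand_def less_imp_le)
  have "(\<integral>\<^sup>+w. (\<Prod>i\<in>I. ennreal (q i (w i - a i) / q i (w i))) * (\<Prod>i\<in>I. ennreal (q i (w i - b i) / q i (w i))) \<partial>PiM I M)
    = (\<integral>\<^sup>+w. (\<Prod>i\<in>I. ennreal (translation_integrand (q i) (a i, b i) (w i))) \<partial>PiM I M)"
    using nvD(2) unfolding translation_integrand_def fst_conv snd_conv prod.distrib[symmetric]
    by (intro nn_integral_cong prod.cong refl ennreal_mult[symmetric]) (auto simp: less_imp_le)
  also have "\<dots> = (\<Prod>i\<in>I. \<integral>\<^sup>+z. ennreal (translation_integrand (q i) (a i, b i) z) \<partial>M i)"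
    using assms(1) int by (intro M.product_nn_integral_prod) auto
  also have "\<dots> = (\<Prod>i\<in>I. ennreal (exp (translation_function (M i) (q i) (a i, b i))))"
    using pos by (intro prod.cong refl)
      (simp add: nn_integral_eq_integral[OF int] exp_translation_function[OF prob nv int])
  also have "\<dots> = ennreal (exp (\<Sum>i\<in>I. translation_function (M i) (q i) (a i, b i)))"
    using assms(1) by (simp add: prod_ennreal exp_sum)
  finally show ?thesis .
qed

text \<open>Let Z be the likelihood averaged over the spikes in \<open>B\<close>. Where Z is at most
  \<open>c\<close>, the event contributes at most \<open>c\<close> times its null probability; where
  Z exceeds \<open>c\<close>, Z is at most Z^2 / c. Unlike Cauchy-Schwarz, this leaves a free level
  \<open>c\<close> and avoids square roots in \<open>ennreal\<close>.\<close>

lemma truncated_second_moment: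
  assumes "prob_space X" "prob_space W"
    and L [measurable]: "(\<lambda>(x, w). L x w) \<in> borel_measurable (X \<Otimes>\<^sub>M W)"
    and B [measurable]: "B \<in> sets X" and E [measurable]: "E \<in> sets W" and "c > 0"
    and bound: "(\<integral>\<^sup>+x. \<integral>\<^sup>+y. indicator B x * indicator B y * (\<integral>\<^sup>+w. L x w * L y w \<partial>W) \<partial>X \<partial>X) \<le> K"
  shows "(\<integral>\<^sup>+x. indicator B x * (\<integral>\<^sup>+w. indicator E w * L x w \<partial>W) \<partial>X)
    \<le> ennreal c * emeasure W E + K * ennreal (1 / c)"
proof -
  interpret X: prob_space X by fact
  interpret W: prob_space W by fact
  interpret XW: pair_sigma_finite X W ..
  have L' [measurable]: "(\<lambda>z. L (f z) (g z)) \<in> borel_measurable N"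
    if "f \<in> measurable N X" "g \<in> measurable N W" for f g N
    using measurable_compose[OF measurable_Pair[OF that] L] by simp
  define Z where "Z w = (\<integral>\<^sup>+x. indicator B x * L x w \<partial>X)" for w
  have Z [measurable]: "Z \<in> borel_measurable W" unfolding Z_def[abs_def] by measurable
  have "(\<integral>\<^sup>+x. indicator B x * (\<integral>\<^sup>+w. indicator E w * L x w \<partial>W) \<partial>X)
    = (\<integral>\<^sup>+x. (\<integral>\<^sup>+w. indicator E w * (indicator B x * L x w) \<partial>W) \<partial>X)"
    by (intro nn_integral_cong) (simp flip: nn_integral_cmult add: mult_ac)
  also have "\<dots> = (\<integral>\<^sup>+w. (\<integral>\<^sup>+x. indicator E w * (indicator B x * L x w) \<partial>X) \<partial>W)"
    by (rule XW.Fubini'[symmetric]) measurable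
  also have "\<dots> = (\<integral>\<^sup>+w. indicator E w * Z w \<partial>W)"
    unfolding Z_def by (intro nn_integral_cong nn_integral_cmult) measurable
  also have "\<dots> \<le> (\<integral>\<^sup>+w. ennreal c * indicator E w + Z w * Z w * ennreal (1 / c) \<partial>W)"
  proof (intro nn_integral_mono)
    fix w
    show "indicator E w * Z w \<le> ennreal c * indicator E w + Z w * Z w * ennreal (1 / c)"
    proof (cases "Z w \<le> ennreal c")
      case True
      then have "indicator E w * Z w \<le> ennreal c * indicator E w"
        by (auto simp: indicator_def)
      then show ?thesis by (rule order_trans) simp
    next
      case False
      have "indicator E w * Z w \<le> Z w * 1" by (auto simp: indicator_def)
      also have "1 = ennreal c * ennreal (1 / c)" using assms(6) by (simp flip: ennreal_mult)
      also have "Z w * (ennreal c * ennreal (1 / c)) \<le> Z w * (Z w * ennreal (1 / c))"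
        using False by (intro mult_left_mono mult_right_mono) auto
      finally show ?thesis by (simp add: mult.assoc add_increasing)
    qed
  qed
  also have "\<dots> = ennreal c * emeasure W E + (\<integral>\<^sup>+w. Z w * Z w \<partial>W) * ennreal (1 / c)"
    by (simp add: nn_integral_add nn_integral_cmult nn_integral_multc)
  \<comment> \<open>The square of an average is an average over two independent spikes, after which
    Tonelli moves the noise integral inside.\<close>
  also have "(\<integral>\<^sup>+w. Z w * Z w \<partial>W)
    = (\<integral>\<^sup>+w. \<integral>\<^sup>+x. \<integral>\<^sup>+y. indicator B x * L x w * (indicator B y * L y w) \<partial>X \<partial>X \<partial>W)"
    unfolding Z_def by (intro nn_integral_cong) (simp add: nn_integral_cmult nn_integral_multc)
  also have "\<dots> = (\<integral>\<^sup>+x. \<integral>\<^sup>+w. \<integral>\<^sup>+y. indicator B x * L x w * (indicator B y * L y w) \<partial>X \<partial>W \<partial>X)"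
    by (rule XW.Fubini') measurable
  also have "\<dots> = (\<integral>\<^sup>+x. \<integral>\<^sup>+y. \<integral>\<^sup>+w. indicator B x * L x w * (indicator B y * L y w) \<partial>W \<partial>X \<partial>X)"
    by (intro nn_integral_cong XW.Fubini') measurable
  also have "\<dots> = (\<integral>\<^sup>+x. \<integral>\<^sup>+y. indicator B x * indicator B y * (\<integral>\<^sup>+w. L x w * L y w \<partial>W) \<partial>X \<partial>X)"
    by (intro nn_integral_cong) (simp flip: nn_integral_cmult add: mult_ac)
  finally show ?thesis
    using bound by (meson add_left_mono mult_right_mono order_trans zero_le)
qed

section \<open>Likelihood ratio of the spiked Wigner model\<close>

lemma sum_upper_triangle:
  "(\<Sum>(i, j)\<in>{(i, j). i \<le> j \<and> j < n}. f i j) = (\<Sum>j<n. (\<Sum>i<j. f i j) + f j j)"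
  for f :: "nat \<Rightarrow> nat \<Rightarrow> real"
proof -
  have "(\<Sum>(i, j)\<in>{(i, j). i \<le> j \<and> j < n}. f i j) = (\<Sum>(j, i)\<in>(SIGMA j:{..<n}. {..j}). f i j)"
    by (rule sum.reindex_bij_witness[where i = prod.swap and j = prod.swap]) auto
  also have "\<dots> = (\<Sum>j<n. \<Sum>i\<le>j. f i j)" by (rule sum.Sigma[symmetric]) auto
  also have "\<dots> = (\<Sum>j<n. (\<Sum>i<j. f i j) + f j j)"
    by (simp flip: lessThan_Suc_atMost)
  finally show ?thesis .
qed

lemma finite_upper_triangle [simp]: "finite {(i, j). i \<le> j \<and> j < (n :: nat)}"
  by (rule finite_subset[of _ "{..n} \<times> {..n}"]) auto

text \<open>The factor \<open>sqrt (real n)\<close> undoes the scaling of the noise, so that the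
  spike becomes a translation of the unscaled entries.\<close>

definition wigner_shift :: "real \<Rightarrow> nat \<Rightarrow> (nat \<Rightarrow> real) \<Rightarrow> nat \<times> nat \<Rightarrow> real" where
  "wigner_shift lam n x = (\<lambda>(i, j). lam * sqrt (real n) * (x i * x j))"

text \<open>The likelihood ratio for a given spike, written on the independent noise entries rather
  than on the symmetric matrix; this keeps it a finite product of one-dimensional ratios.\<close>

definition wigner_likelihood ::
  "real \<Rightarrow> (real \<Rightarrow> real) \<Rightarrow> (real \<Rightarrow> real) \<Rightarrow> nat \<Rightarrow> (nat \<Rightarrow> real) \<Rightarrow> (nat \<times> nat \<Rightarrow> real) \<Rightarrow> ennreal" where
  "wigner_likelihood lam p pd n x w = (\<Prod>ij\<in>{(i, j). i \<le> j \<and> j < n}.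
     ennreal ((if fst ij = snd ij then pd else p) (w ij - wigner_shift lam n x ij)
        / (if fst ij = snd ij then pd else p) (w ij)))"

text \<open>A spiked matrix is the null matrix map applied to shifted noise. The vector
  \<open>y\<close> is arbitrary because its coefficient is 0.\<close>

lemma spiked_matrix_shift:
  assumes "n > 0"
  shows "spiked_matrix lam n x w
    = spiked_matrix 0 n y (\<lambda>ij\<in>{(i, j). i \<le> j \<and> j < n}. w ij + wigner_shift lam n x ij)"
proof
  fix ij
  show "spiked_matrix lam n x w ij
    = spiked_matrix 0 n y (\<lambda>ij\<in>{(i, j). i \<le> j \<and> j < n}. w ij + wigner_shift lam n x ij) ij"
  proof (cases "ij \<in> {..<n} \<times> {..<n}")
    case True
    then obtain i j where ij: "ij = (i, j)" "i < n" "j < n" by auto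
    show ?thesis using ij assms
      by (cases "i \<le> j") (auto simp: spiked_matrix_def wigner_shift_def add_divide_distrib mult_ac)
  qed (auto simp: spiked_matrix_def)
qed

locale wigner_model =
  fixes P Pd :: "real measure" and p pd :: "real \<Rightarrow> real"
  assumes prob_P: "prob_space P" and prob_Pd: "prob_space Pd"
    and nv: "nonvanishing_density P p" and nvd: "nonvanishing_density Pd pd"
begin

lemma prob_entry: "prob_space (if fst ij = snd ij then Pd else P)"
  using prob_P prob_Pd by simp

lemma nonvanishing_entry:
  "nonvanishing_density (if fst ij = snd ij then Pd else P) (if fst ij = snd ij then pd else p)"
  using nv nvd by simp

lemma prob_space_noise: "prob_space (wigner_noise P Pd n)"
  unfolding wigner_noise_def by (rule prob_space_PiM) (rule prob_entry)

lemma sets_noise [measurable_cong]: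
  "sets (wigner_noise P Pd n) = sets (\<Pi>\<^sub>M ij\<in>{(i, j). i \<le> j \<and> j < n}. borel)"
  unfolding wigner_noise_def
  using nonvanishing_densityD(5)[OF nv] nonvanishing_densityD(5)[OF nvd] by (intro sets_PiM_cong) auto

lemma spiked_matrix_measurable [measurable]:
  assumes [measurable]: "f \<in> measurable M (vec_space n)"
    and [measurable]: "g \<in> measurable M (wigner_noise P Pd n)"
  shows "(\<lambda>z. spiked_matrix lam n (f z) (g z)) \<in> measurable M (mat_space n)"
proof -
  have f: "(\<lambda>z. f z i) \<in> borel_measurable M" if "i < n" for i
    using that by (intro measurable_compose[OF assms(1) measurable_component_singleton]) simp
  have g': "g \<in> measurable M (\<Pi>\<^sub>M ij\<in>{(i, j). i \<le> j \<and> j < n}. borel)"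
    using assms(2) by (simp add: measurable_cong_sets[OF refl sets_noise])
  have g: "(\<lambda>z. g z (min i j, max i j)) \<in> borel_measurable M" if "i < n" "j < n" for i j
    using that by (intro measurable_compose[OF g' measurable_component_singleton]) auto
  show ?thesis unfolding spiked_matrix_def
  proof (rule measurable_restrict)
    fix ij assume "ij \<in> {..<n} \<times> {..<n}"
    then obtain i j where ij: "ij = (i, j)" "i < n" "j < n" by auto
    note [measurable] = f[OF ij(2)] f[OF ij(3)] g[OF ij(2,3)]
    show "(\<lambda>z. case ij of (i, j) \<Rightarrow> lam * (f z i * f z j) + g z (min i j, max i j) / sqrt (real n))
      \<in> borel_measurable M" unfolding ij(1) split by measurable
  qed
qed

lemma wigner_likelihood_measurable [measurable]:
  "(\<lambda>(x, w). wigner_likelihood lam p pd n x w) \<in> borel_measurable (vec_space n \<Otimes>\<^sub>M wigner_noise P Pd n)"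
proof -
  let ?M = "vec_space n \<Otimes>\<^sub>M wigner_noise P Pd n"
  have x: "(\<lambda>z. fst z i) \<in> borel_measurable ?M" if "i < n" for i
    using that by (intro measurable_compose[OF measurable_fst measurable_component_singleton]) simp
  have snd: "snd \<in> measurable ?M (\<Pi>\<^sub>M ij\<in>{(i, j). i \<le> j \<and> j < n}. borel)"
    using measurable_snd[of "vec_space n" "wigner_noise P Pd n"]
    by (simp add: measurable_cong_sets[OF refl sets_noise])
  have w: "(\<lambda>z. snd z ij) \<in> borel_measurable ?M" if "ij \<in> {(i, j). i \<le> j \<and> j < n}" for ij
    using that by (intro measurable_compose[OF snd measurable_component_singleton]) simp
  show ?thesis unfolding wigner_likelihood_def case_prod_unfold
  proof (intro borel_measurable_prod_ennreal)
    fix ij assume ij: "ij \<in> {ij. fst ij \<le> snd ij \<and> snd ij < n}"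
    then have [measurable]: "(\<lambda>z. wigner_shift lam n (fst z) ij) \<in> borel_measurable ?M"
      unfolding wigner_shift_def case_prod_unfold
      by (intro borel_measurable_times borel_measurable_const x) auto
    have [measurable]: "(\<lambda>z. snd z ij) \<in> borel_measurable ?M" using ij by (intro w) auto
    note [measurable] = nonvanishing_densityD(1)[OF nonvanishing_entry[of ij]]
    show "(\<lambda>z. ennreal ((if fst ij = snd ij then pd else p) (snd z ij - wigner_shift lam n (fst z) ij)
        / (if fst ij = snd ij then pd else p) (snd z ij))) \<in> borel_measurable ?M"
      by measurable
  qed
qed

lemma nn_integral_shift_noise:
  assumes [measurable]: "f \<in> borel_measurable (\<Pi>\<^sub>M ij\<in>{(i, j). i \<le> j \<and> j < n}. borel)"
  shows "(\<integral>\<^sup>+w. f (\<lambda>ij\<in>{(i, j). i \<le> j \<and> j < n}. w ij + wigner_shift lam n x ij) \<partial>wigner_noise P Pd n)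
    = (\<integral>\<^sup>+w. f w * wigner_likelihood lam p pd n x w \<partial>wigner_noise P Pd n)"
proof -
  let ?I = "{(i, j). i \<le> j \<and> j < n}"
  let ?R = "\<lambda>w. \<lambda>ij\<in>?I. w ij + wigner_shift lam n x ij"
  have w: "(\<lambda>w. w ij) \<in> borel_measurable (wigner_noise P Pd n)" if "ij \<in> ?I" for ij
    using that unfolding measurable_cong_sets[OF sets_noise refl] by simp
  have R [measurable]: "?R \<in> measurable (wigner_noise P Pd n) (\<Pi>\<^sub>M ij\<in>?I. borel)"
    by (intro measurable_restrict borel_measurable_add borel_measurable_const w)
  have L [measurable]: "wigner_likelihood lam p pd n x \<in> borel_measurable (wigner_noise P Pd n)"
    unfolding wigner_likelihood_def[abs_def]
  proof (intro borel_measurable_prod_ennreal)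
    fix ij assume "ij \<in> ?I"
    note [measurable] = w[OF this] nonvanishing_densityD(1)[OF nonvanishing_entry[of ij]]
    show "(\<lambda>w. ennreal ((if fst ij = snd ij then pd else p) (w ij - wigner_shift lam n x ij)
        / (if fst ij = snd ij then pd else p) (w ij))) \<in> borel_measurable (wigner_noise P Pd n)"
      by measurable
  qed
  have "(\<integral>\<^sup>+w. f (?R w) \<partial>wigner_noise P Pd n)
    = (\<integral>\<^sup>+w. f w \<partial>distr (wigner_noise P Pd n) (\<Pi>\<^sub>M ij\<in>?I. borel) ?R)"
    by (subst nn_integral_distr) measurable
  also have "distr (wigner_noise P Pd n) (\<Pi>\<^sub>M ij\<in>?I. borel) ?R
    = density (wigner_noise P Pd n) (wigner_likelihood lam p pd n x)"
    unfolding wigner_noise_def wigner_likelihood_def[abs_def]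
    by (rule distr_PiM_shift_eq_density[OF _ prob_entry nonvanishing_entry]) simp
  also have "(\<integral>\<^sup>+w. f w \<partial>\<dots>) = (\<integral>\<^sup>+w. wigner_likelihood lam p pd n x w * f w \<partial>wigner_noise P Pd n)"
    by (intro nn_integral_density) measurable
  also have "\<dots> = (\<integral>\<^sup>+w. f w * wigner_likelihood lam p pd n x w \<partial>wigner_noise P Pd n)"
    by (simp only: mult.commute)
  finally show ?thesis .
qed

lemma nn_integral_wigner_likelihood:
  assumes int: "\<And>i j. i < n \<Longrightarrow> j < n \<Longrightarrow>
      integrable P (translation_integrand p (lam * sqrt (real n) * (x i * x j), lam * sqrt (real n) * (y i * y j)))"
    and intd: "\<And>i. i < n \<Longrightarrow>
      integrable Pd (translation_integrand pd (lam * sqrt (real n) * (x i * x i), lam * sqrt (real n) * (y i * y i)))"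
  shows "(\<integral>\<^sup>+w. wigner_likelihood lam p pd n x w * wigner_likelihood lam p pd n y w \<partial>wigner_noise P Pd n)
    = ennreal (exp (\<Sum>j<n.
        (\<Sum>i<j. translation_function P p (lam * sqrt (real n) * (x i * x j), lam * sqrt (real n) * (y i * y j)))
        + translation_function Pd pd (lam * sqrt (real n) * (x j * x j), lam * sqrt (real n) * (y j * y j))))"
proof -
  let ?I = "{(i, j). i \<le> j \<and> j < n}"
  let ?T = "\<lambda>i j. translation_function (if i = j then Pd else P) (if i = j then pd else p)
    (lam * sqrt (real n) * (x i * x j), lam * sqrt (real n) * (y i * y j))"
  have "(\<integral>\<^sup>+w. wigner_likelihood lam p pd n x w * wigner_likelihood lam p pd n y w \<partial>wigner_noise P Pd n)
    = ennreal (exp (\<Sum>ij\<in>?I. translation_function (if fst ij = snd ij then Pd else P)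
        (if fst ij = snd ij then pd else p) (wigner_shift lam n x ij, wigner_shift lam n y ij)))"
    unfolding wigner_noise_def wigner_likelihood_def[abs_def]
  proof (rule nn_integral_likelihood_product[OF _ prob_entry nonvanishing_entry])
    fix ij assume "ij \<in> ?I"
    then obtain i j where "ij = (i, j)" "i < n" "j < n" by auto
    then show "integrable (if fst ij = snd ij then Pd else P)
      (translation_integrand (if fst ij = snd ij then pd else p) (wigner_shift lam n x ij, wigner_shift lam n y ij))"
      using int intd by (auto simp: wigner_shift_def)
  qed simp
  also have "(\<Sum>ij\<in>?I. translation_function (if fst ij = snd ij then Pd else P)
        (if fst ij = snd ij then pd else p) (wigner_shift lam n x ij, wigner_shift lam n y ij))
     = (\<Sum>(i, j)\<in>?I. ?T i j)"
    by (intro sum.cong refl) (auto simp: wigner_shift_def)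
  also have "\<dots> = (\<Sum>j<n. (\<Sum>i<j. ?T i j) + ?T j j)" by (rule sum_upper_triangle)
  also have "\<dots> = (\<Sum>j<n.
        (\<Sum>i<j. translation_function P p (lam * sqrt (real n) * (x i * x j), lam * sqrt (real n) * (y i * y j)))
        + translation_function Pd pd (lam * sqrt (real n) * (x j * x j), lam * sqrt (real n) * (y j * y j)))"
    by (intro sum.cong arg_cong2[where f = "(+)"] refl) auto
  finally show ?thesis .
qed

lemma emeasure_Wig:
  assumes "prob_space (X n)" and sX: "sets (X n) = sets (vec_space n)" and "A \<in> sets (mat_space n)"
  shows "emeasure (Wig lam P Pd X n) A
    = (\<integral>\<^sup>+x. \<integral>\<^sup>+w. indicator A (spiked_matrix lam n x w) \<partial>wigner_noise P Pd n \<partial>X n)"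
proof -
  interpret W: prob_space "wigner_noise P Pd n" by (rule prob_space_noise)
  note [measurable_cong] = sX
  note [measurable] = assms(3)
  have [measurable]: "(\<lambda>(x, w). spiked_matrix lam n x w) \<in> measurable (X n \<Otimes>\<^sub>M wigner_noise P Pd n) (mat_space n)"
    by measurable
  have "emeasure (Wig lam P Pd X n) A = (\<integral>\<^sup>+z. indicator A z \<partial>Wig lam P Pd X n)"
    using assms(3) by (simp add: Wig_def)
  also have "\<dots> = (\<integral>\<^sup>+(x, w). indicator A (spiked_matrix lam n x w) \<partial>(X n \<Otimes>\<^sub>M wigner_noise P Pd n))"
    unfolding Wig_def by (subst nn_integral_distr) (auto simp: case_prod_unfold)
  also have "\<dots> = (\<integral>\<^sup>+x. \<integral>\<^sup>+w. indicator A (spiked_matrix lam n x w) \<partial>wigner_noise P Pd n \<partial>X n)"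
    by (subst W.nn_integral_fst[symmetric]) (auto simp: case_prod_unfold)
  finally show ?thesis .
qed

text \<open>Spikes outside \<open>B\<close> cost at most their probability. For the others a change
  of measure moves the spike into the likelihood ratio, and the second moment inequality applies
  with the preimage of \<open>A\<close> in noise space.\<close>

lemma emeasure_Wig_le:
  assumes "prob_space (X n)" and sX: "sets (X n) = sets (vec_space n)" and A: "A \<in> sets (mat_space n)"
    and "n > 0" "c > 0" and B: "B \<in> sets (X n)"
    and bound: "(\<integral>\<^sup>+x. \<integral>\<^sup>+y. indicator B x * indicator B y *
      (\<integral>\<^sup>+w. wigner_likelihood lam p pd n x w * wigner_likelihood lam p pd n y w \<partial>wigner_noise P Pd n) \<partial>X n \<partial>X n) \<le> K"
  shows "emeasure (Wig lam P Pd X n) A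
    \<le> emeasure (X n) (space (X n) - B) + (ennreal c * emeasure (Wig 0 P Pd X n) A + K * ennreal (1 / c))"
proof -
  interpret X: prob_space "X n" by fact
  interpret W: prob_space "wigner_noise P Pd n" by (rule prob_space_noise)
  let ?W = "wigner_noise P Pd n" and ?L = "wigner_likelihood lam p pd n"
  let ?I = "{(i, j). i \<le> j \<and> j < n}"
  note [measurable_cong] = sX
  note [measurable] = A B
  \<comment> \<open>At signal strength 0 the matrix does not see the spike, so one fixed map from
    noise to matrices describes the null model.\<close>
  define S where "S = spiked_matrix 0 n (\<lambda>_. 0)"
  have S: "spiked_matrix 0 n x = S" for x by (auto simp: S_def spiked_matrix_def fun_eq_iff)
  have z: "(\<lambda>i\<in>{..<n}. 0) \<in> space (vec_space n)" by (simp add: space_PiM)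
  have S_meas [measurable]: "S \<in> measurable ?W (mat_space n)"
  proof -
    have "(\<lambda>w. spiked_matrix 0 n (\<lambda>i\<in>{..<n}. 0) w) \<in> measurable ?W (mat_space n)"
      using z by (intro spiked_matrix_measurable) auto
    then show ?thesis by (simp add: S)
  qed
  define E where "E = S -` A \<inter> space ?W"
  have E [measurable]: "E \<in> sets ?W" unfolding E_def by measurable
  have L [measurable]: "(\<lambda>(x, w). ?L x w) \<in> borel_measurable (X n \<Otimes>\<^sub>M ?W)"
    using wigner_likelihood_measurable by (simp add: measurable_cong_sets[OF sets_pair_measure_cong[OF sX refl] refl])
  have Wig0: "emeasure (Wig 0 P Pd X n) A = emeasure ?W E"
  proof -
    have "emeasure (Wig 0 P Pd X n) A = (\<integral>\<^sup>+x. \<integral>\<^sup>+w. indicator A (S w) \<partial>?W \<partial>X n)"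
      unfolding emeasure_Wig[where X = X and n = n, OF assms(1-3)] S ..
    also have "\<dots> = (\<integral>\<^sup>+w. indicator A (S w) \<partial>?W)" by (simp add: X.emeasure_space_1)
    also have "\<dots> = (\<integral>\<^sup>+w. indicator E w \<partial>?W)"
      by (intro nn_integral_cong) (auto simp: E_def indicator_def)
    finally show ?thesis by simp
  qed
  have inner: "(\<integral>\<^sup>+w. indicator A (spiked_matrix lam n x w) \<partial>?W) = (\<integral>\<^sup>+w. indicator E w * ?L x w \<partial>?W)" for x
  proof -
    have m: "(\<lambda>w. indicator A (S w) :: ennreal) \<in> borel_measurable (\<Pi>\<^sub>M ij\<in>?I. borel)"
      unfolding measurable_cong_sets[OF sets_noise refl, symmetric] by measurable
    have "(\<integral>\<^sup>+w. indicator A (spiked_matrix lam n x w) \<partial>?W)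
      = (\<integral>\<^sup>+w. indicator A (S (\<lambda>ij\<in>?I. w ij + wigner_shift lam n x ij)) \<partial>?W)"
      by (subst spiked_matrix_shift[OF assms(4), of lam x _ "\<lambda>_. 0"]) (simp add: S_def)
    also have "\<dots> = (\<integral>\<^sup>+w. indicator A (S w) * ?L x w \<partial>?W)"
      by (rule nn_integral_shift_noise[OF m])
    also have "\<dots> = (\<integral>\<^sup>+w. indicator E w * ?L x w \<partial>?W)"
      by (intro nn_integral_cong) (auto simp: E_def indicator_def)
    finally show ?thesis .
  qed
  have inner1: "(\<integral>\<^sup>+w. indicator A (spiked_matrix lam n x w) \<partial>?W) \<le> 1" for x
  proof -
    have "(\<integral>\<^sup>+w. indicator A (spiked_matrix lam n x w) \<partial>?W) \<le> (\<integral>\<^sup>+w. 1 \<partial>?W)"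
      by (intro nn_integral_mono) (auto simp: indicator_def)
    then show ?thesis by (simp add: W.emeasure_space_1)
  qed
  have "emeasure (Wig lam P Pd X n) A
    = (\<integral>\<^sup>+x. \<integral>\<^sup>+w. indicator A (spiked_matrix lam n x w) \<partial>?W \<partial>X n)"
    by (rule emeasure_Wig[where X = X and n = n, OF assms(1-3)])
  also have "\<dots> \<le> (\<integral>\<^sup>+x. indicator (space (X n) - B) x + indicator B x * (\<integral>\<^sup>+w. indicator E w * ?L x w \<partial>?W) \<partial>X n)"
  proof (intro nn_integral_mono)
    fix x assume "x \<in> space (X n)"
    then show "(\<integral>\<^sup>+w. indicator A (spiked_matrix lam n x w) \<partial>?W)
      \<le> indicator (space (X n) - B) x + indicator B x * (\<integral>\<^sup>+w. indicator E w * ?L x w \<partial>?W)"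
      using inner1[of x] by (cases "x \<in> B") (auto simp: inner)
  qed
  also have "\<dots> = emeasure (X n) (space (X n) - B) + (\<integral>\<^sup>+x. indicator B x * (\<integral>\<^sup>+w. indicator E w * ?L x w \<partial>?W) \<partial>X n)"
    by (subst nn_integral_add) auto
  also have "\<dots> \<le> emeasure (X n) (space (X n) - B) + (ennreal c * emeasure ?W E + K * ennreal (1 / c))"
    by (intro add_left_mono truncated_second_moment[OF assms(1) prob_space_noise L B E assms(5) bound])
  finally show ?thesis by (simp add: Wig0)
qed

end

section \<open>Good spikes and convexity bounds\<close>

lemma sum_power_le_of_lq_norm_le:
  assumes "lq_norm (real q) n x \<le> \<alpha> * real n powr (1 / real q - 1 / 2)" "even q" "q > 0"
  shows "(\<Sum>i<n. x i ^ q) \<le> \<bar>\<alpha>\<bar> ^ q * real n powr (1 - real q / 2)"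
proof -
  have "(\<Sum>i<n. \<bar>x i\<bar> powr real q) = (\<Sum>i<n. x i ^ q)"
    using assms(2,3) by (intro sum.cong refl) (simp add: powr_realpow' power_even_abs)
  moreover have "(\<Sum>i<n. x i ^ q) \<ge> 0" using assms(2) by (intro sum_nonneg) (simp add: zero_le_even_power)
  ultimately have "(\<Sum>i<n. x i ^ q) = lq_norm (real q) n x ^ q"
    using assms(3) powr_powr[of "\<Sum>i<n. x i ^ q" "1 / real q" "real q"]
    by (simp add: lq_norm_def powr_realpow')
  also have "\<dots> \<le> (\<bar>\<alpha>\<bar> * real n powr (1 / real q - 1 / 2)) ^ q"
  proof (rule power_mono)
    have "\<alpha> * real n powr (1 / real q - 1 / 2) \<le> \<bar>\<alpha>\<bar> * real n powr (1 / real q - 1 / 2)"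
      by (intro mult_right_mono) auto
    with assms(1) show "lq_norm (real q) n x \<le> \<bar>\<alpha>\<bar> * real n powr (1 / real q - 1 / 2)" by linarith
  qed (simp add: lq_norm_def)
  also have "\<dots> = \<bar>\<alpha>\<bar> ^ q * real n powr ((1 / real q - 1 / 2) * real q)"
    using assms(3) powr_realpow'[of "real n powr (1 / real q - 1 / 2)" q]
    by (simp add: power_mult_distrib powr_powr)
  also have "(1 / real q - 1 / 2) * real q = 1 - real q / 2" using assms(3) by (simp add: field_simps)
  finally show ?thesis .
qed

lemma (in prob_space) prob_Int_ge:
  assumes "A \<in> events" "B \<in> events"
  shows "prob (A \<inter> B) \<ge> prob A + prob B - 1"
proof -
  have "prob (A - B) \<le> prob (space M - B)"
    using assms sets.sets_into_space by (intro finite_measure_mono) auto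
  then show ?thesis
    using finite_measure_Diff'[OF assms] prob_compl[OF assms(2)] by simp
qed

lemma component_measurable:
  assumes "sets M = sets (vec_space n)" "i < n"
  shows "(\<lambda>x. x i) \<in> borel_measurable M"
  unfolding measurable_cong_sets[OF assms(1) refl]
  using assms(2) by (intro measurable_component_singleton) simp

lemma delocalized_sets:
  assumes "sets M = sets (vec_space n)"
  shows "{x \<in> space M. delocalized K n x} \<in> sets M"
proof -
  have [measurable]: "(\<lambda>x. \<Sum>i<n. x i ^ k) \<in> borel_measurable M" for k
    by (intro borel_measurable_sum borel_measurable_power component_measurable[OF assms]) simp
  show ?thesis unfolding delocalized_def by measurable
qed

lemma delocalized_with_high_probability:
  assumes prob: "\<And>n. prob_space (X n)" and sX: "\<And>n. sets (X n) = sets (vec_space n)"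
    and lq: "\<And>q :: nat. q \<in> {2, 4, 6, 8} \<Longrightarrow>
           \<exists>\<alpha> :: real. (\<lambda>n. measure (X n)
             {x \<in> space (X n). lq_norm (real q) n x \<le> \<alpha> * real n powr (1 / real q - 1 / 2)}) \<longlonglongrightarrow> 1"
  obtains K where "(\<lambda>n. measure (X n) {x \<in> space (X n). delocalized K n x}) \<longlonglongrightarrow> 1"
proof -
  have "\<forall>q\<in>{2, 4, 6, 8 :: nat}. \<exists>\<alpha> :: real. (\<lambda>n. measure (X n)
      {x \<in> space (X n). lq_norm (real q) n x \<le> \<alpha> * real n powr (1 / real q - 1 / 2)}) \<longlonglongrightarrow> 1"
    using lq by (rule ballI)
  from bchoice[OF this] obtain \<alpha> where \<alpha>: "\<forall>q\<in>{2, 4, 6, 8 :: nat}. (\<lambda>n. measure (X n)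
      {x \<in> space (X n). lq_norm (real q) n x \<le> \<alpha> q * real n powr (1 / real q - 1 / 2)}) \<longlonglongrightarrow> 1"
    by (elim exE)
  define G where "G q n = {x \<in> space (X n). lq_norm (real q) n x \<le> \<alpha> q * real n powr (1 / real q - 1 / 2)}" for q n
  \<comment> \<open>The sum is a single constant dominating all four.\<close>
  define K where "K = (\<Sum>q\<in>{2, 4, 6, 8 :: nat}. \<bar>\<alpha> q\<bar> ^ q)"
  have G: "G q n \<in> sets (X n)" for q n
  proof -
    have [measurable]: "(\<lambda>x. x i) \<in> borel_measurable (X n)" if "i \<in> {..<n}" for i
      using that by (intro component_measurable[OF sX]) simp
    show ?thesis unfolding G_def lq_norm_def by measurable
  qed
  have K: "\<bar>\<alpha> q\<bar> ^ q \<le> K" if "q \<in> {2, 4, 6, 8}" for q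
    unfolding K_def using that by (intro member_le_sum) auto
  have sub: "G 2 n \<inter> G 4 n \<inter> (G 6 n \<inter> G 8 n) \<subseteq> {x \<in> space (X n). delocalized K n x}" if "n > 0" for n
  proof
    fix x assume x: "x \<in> G 2 n \<inter> G 4 n \<inter> (G 6 n \<inter> G 8 n)"
    have *: "(\<Sum>i<n. x i ^ q) \<le> K * real n powr (1 - real q / 2)" if "q \<in> {2, 4, 6, 8}" for q
    proof -
      have "(\<Sum>i<n. x i ^ q) \<le> \<bar>\<alpha> q\<bar> ^ q * real n powr (1 - real q / 2)"
        using x that by (intro sum_power_le_of_lq_norm_le) (auto simp: G_def)
      also have "\<dots> \<le> K * real n powr (1 - real q / 2)" by (intro mult_right_mono K that) simp
      finally show ?thesis .
    qed
    have pw: "real n powr (- 1) = 1 / real n" "real n powr (- 2) = 1 / real n ^ 2"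
      "real n powr (- 3) = 1 / real n ^ 3"
      using that by (simp_all add: powr_minus divide_inverse powr_numeral)
    have "delocalized K n x"
      using *[of 2] *[of 4] *[of 6] *[of 8] that by (simp add: delocalized_def pw)
    then show "x \<in> {x \<in> space (X n). delocalized K n x}" using x by (simp add: G_def)
  qed
  \<comment> \<open>Each of the three intersections of near-certain events costs 1, which gives the
    3.\<close>
  have lower: "measure (X n) (G 2 n) + measure (X n) (G 4 n) + measure (X n) (G 6 n) + measure (X n) (G 8 n) - 3
      \<le> measure (X n) {x \<in> space (X n). delocalized K n x}" if "n > 0" for n
  proof -
    interpret prob_space "X n" by (rule prob)
    have "prob (G 2 n \<inter> G 4 n \<inter> (G 6 n \<inter> G 8 n)) \<le> prob {x \<in> space (X n). delocalized K n x}"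
      by (intro finite_measure_mono sub that delocalized_sets sX)
    moreover have "prob (G 2 n \<inter> G 4 n) + prob (G 6 n \<inter> G 8 n) - 1 \<le> prob (G 2 n \<inter> G 4 n \<inter> (G 6 n \<inter> G 8 n))"
      by (intro prob_Int_ge sets.Int G)
    ultimately show ?thesis
      using prob_Int_ge[OF G[of 2 n] G[of 4 n]] prob_Int_ge[OF G[of 6 n] G[of 8 n]] by linarith
  qed
  have "(\<lambda>n. measure (X n) {x \<in> space (X n). delocalized K n x}) \<longlonglongrightarrow> 1"
  proof (rule tendsto_sandwich)
    have "(\<lambda>n. measure (X n) (G 2 n) + measure (X n) (G 4 n) + measure (X n) (G 6 n) + measure (X n) (G 8 n) - 3)
      \<longlonglongrightarrow> 1 + 1 + 1 + 1 - 3"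
      unfolding G_def by (intro tendsto_intros bspec[OF \<alpha>]) auto
    then show "(\<lambda>n. measure (X n) (G 2 n) + measure (X n) (G 4 n) + measure (X n) (G 6 n) + measure (X n) (G 8 n) - 3)
      \<longlonglongrightarrow> 1" by simp
    show "\<forall>\<^sub>F n in sequentially. measure (X n) (G 2 n) + measure (X n) (G 4 n) + measure (X n) (G 6 n) + measure (X n) (G 8 n) - 3
      \<le> measure (X n) {x \<in> space (X n). delocalized K n x}"
      using eventually_gt_at_top[of 0] by eventually_elim (rule lower)
    show "\<forall>\<^sub>F n in sequentially. measure (X n) {x \<in> space (X n). delocalized K n x} \<le> 1"
      using prob by (intro always_eventually allI prob_space.prob_le_1)
  qed simp
  then show thesis by (rule that)
qed

section \<open>Consequences of the expansion of the translation function\<close>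

lemma abs_triangle3:
  fixes x :: real
  assumes "\<bar>x - y1 - y2 - y3\<bar> \<le> r" "\<bar>y1\<bar> \<le> z1" "\<bar>y2\<bar> \<le> z2" "\<bar>y3\<bar> \<le> z3" "r \<le> z4"
  shows "\<bar>x\<bar> \<le> z1 + z2 + z3 + z4" "\<bar>x - y1\<bar> \<le> z2 + z3 + z4"
  using assms by linarith+

text \<open>A cruder estimate, meant for the diagonal. With only n entries there, C |a b| already
  sums to a constant, by the bound on \<open>n * (\<Sum>i<n. (x i * y i)\<^sup>2)\<close>; hence no
  Fisher information of the diagonal law enters the threshold.\<close>

lemma translation_function_le_product:
  assumes "prob_space P" "nonvanishing_density P p" "translation_C4_near_0 P p"
  obtains C d where "C \<ge> 0" "d > 0"
    "\<And>a b. \<bar>a\<bar> \<le> d \<Longrightarrow> \<bar>b\<bar> \<le> d \<Longrightarrow> integrable P (translation_integrand p (a, b)) \<and>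
       \<bar>translation_function P p (a, b)\<bar> \<le> C * (\<bar>a\<bar> * \<bar>b\<bar>)"
proof -
  obtain h c1 c2 C d where C: "C \<ge> 0" and d: "d > 0" and
    exps: "\<And>a b. \<bar>a\<bar> \<le> d \<Longrightarrow> \<bar>b\<bar> \<le> d \<Longrightarrow> integrable P (translation_integrand p (a, b)) \<and>
       \<bar>translation_function P p (a, b) - h * (a * b) - c1 * (a\<^sup>2 * b) - c2 * (a * b\<^sup>2)\<bar>
         \<le> C * (\<bar>a\<bar> * \<bar>b\<bar> * (a\<^sup>2 + b\<^sup>2))"
    by (rule translation_function_expansion[OF assms]) (rule that)
  show thesis
  proof (rule that[of "\<bar>h\<bar> + \<bar>c1\<bar> * d + \<bar>c2\<bar> * d + C * (2 * d\<^sup>2)" d])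
    fix a b assume ab: "\<bar>a\<bar> \<le> d" "\<bar>b\<bar> \<le> d"
    let ?s = "\<bar>a\<bar> * \<bar>b\<bar>"
    have s: "?s \<ge> 0" by simp
    have "\<bar>c1 * (a\<^sup>2 * b)\<bar> = \<bar>c1\<bar> * \<bar>a\<bar> * ?s" by (simp add: abs_mult power2_eq_square)
    also have "\<dots> \<le> \<bar>c1\<bar> * d * ?s" using ab by (intro mult_right_mono mult_left_mono) auto
    finally have t1: "\<bar>c1 * (a\<^sup>2 * b)\<bar> \<le> \<bar>c1\<bar> * d * ?s" .
    have "\<bar>c2 * (a * b\<^sup>2)\<bar> = \<bar>c2\<bar> * \<bar>b\<bar> * ?s" by (simp add: abs_mult power2_eq_square)
    also have "\<dots> \<le> \<bar>c2\<bar> * d * ?s" using ab by (intro mult_right_mono mult_left_mono) auto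
    finally have t2: "\<bar>c2 * (a * b\<^sup>2)\<bar> \<le> \<bar>c2\<bar> * d * ?s" .
    have "a\<^sup>2 + b\<^sup>2 \<le> 2 * d\<^sup>2" using power_mono[OF ab(1), of 2] power_mono[OF ab(2), of 2] by simp
    then have "C * (?s * (a\<^sup>2 + b\<^sup>2)) \<le> C * (?s * (2 * d\<^sup>2))" using C s by (intro mult_left_mono) auto
    then have t3: "C * (?s * (a\<^sup>2 + b\<^sup>2)) \<le> C * (2 * d\<^sup>2) * ?s" by (simp add: mult_ac)
    have t4: "\<bar>h * (a * b)\<bar> = \<bar>h\<bar> * ?s" by (simp add: abs_mult)
    have "\<bar>translation_function P p (a, b)\<bar> \<le> \<bar>h\<bar> * ?s + \<bar>c1\<bar> * d * ?s + \<bar>c2\<bar> * d * ?s + C * (2 * d\<^sup>2) * ?s"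
      by (rule abs_triangle3(1)[OF conjunct2[OF exps[OF ab]] eq_refl[OF t4] t1 t2 t3])
    then show "integrable P (translation_integrand p (a, b)) \<and> \<bar>translation_function P p (a, b)\<bar>
      \<le> (\<bar>h\<bar> + \<bar>c1\<bar> * d + \<bar>c2\<bar> * d + C * (2 * d\<^sup>2)) * ?s"
      using exps[OF ab] by (simp only: distrib_right)
  qed (use C d in auto)
qed

lemma expansion_coefficient_le_fisher:
  assumes "prob_space P" "nonvanishing_density P p" "\<And>w. p differentiable (at w)" "C \<ge> 0" "d > 0"
    and exps: "\<And>a b. \<bar>a\<bar> \<le> d \<Longrightarrow> \<bar>b\<bar> \<le> d \<Longrightarrow> integrable P (translation_integrand p (a, b)) \<and>
       \<bar>translation_function P p (a, b) - h * (a * b) - c1 * (a\<^sup>2 * b) - c2 * (a * b\<^sup>2)\<bar>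
         \<le> C * (\<bar>a\<bar> * \<bar>b\<bar> * (a\<^sup>2 + b\<^sup>2))"
  shows "h \<le> fisher_information P p"
proof (rule mixed_coefficient_le_fisher[OF assms(1-3,5), where M = "\<bar>c1\<bar> + \<bar>c2\<bar> + C * d"])
  fix a b assume ab: "\<bar>a\<bar> \<le> d" "\<bar>b\<bar> \<le> d"
  show "integrable P (translation_integrand p (a, b))" using exps[OF ab] by simp
  let ?s = "\<bar>a\<bar> * \<bar>b\<bar>" and ?t = "\<bar>a\<bar> + \<bar>b\<bar>"
  have "\<bar>c1 * (a\<^sup>2 * b)\<bar> = \<bar>c1\<bar> * (?s * \<bar>a\<bar>)" by (simp add: abs_mult power2_eq_square)
  also have "\<dots> \<le> \<bar>c1\<bar> * (?s * ?t)" by (intro mult_left_mono) auto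
  finally have t1: "\<bar>c1 * (a\<^sup>2 * b)\<bar> \<le> \<bar>c1\<bar> * (?s * ?t)" .
  have "\<bar>c2 * (a * b\<^sup>2)\<bar> = \<bar>c2\<bar> * (?s * \<bar>b\<bar>)" by (simp add: abs_mult power2_eq_square)
  also have "\<dots> \<le> \<bar>c2\<bar> * (?s * ?t)" by (intro mult_left_mono) auto
  finally have t2: "\<bar>c2 * (a * b\<^sup>2)\<bar> \<le> \<bar>c2\<bar> * (?s * ?t)" .
  have "\<bar>a\<bar> * \<bar>a\<bar> + \<bar>b\<bar> * \<bar>b\<bar> \<le> d * \<bar>a\<bar> + d * \<bar>b\<bar>"
    using ab by (intro add_mono mult_right_mono) auto
  then have "a\<^sup>2 + b\<^sup>2 \<le> d * ?t" by (simp add: power2_eq_square distrib_left)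
  then have "C * (?s * (a\<^sup>2 + b\<^sup>2)) \<le> C * (?s * (d * ?t))" using assms(4) by (intro mult_left_mono) auto
  then have t3: "C * (?s * (a\<^sup>2 + b\<^sup>2)) \<le> C * d * (?s * ?t)" by (simp only: mult_ac)
  have "\<bar>translation_function P p (a, b) - h * (a * b)\<bar> \<le> \<bar>c1\<bar> * (?s * ?t) + \<bar>c2\<bar> * (?s * ?t) + C * d * (?s * ?t)"
    by (rule abs_triangle3(2)[OF conjunct2[OF exps[OF ab]] order_refl t1 t2 t3])
  then show "\<bar>translation_function P p (a, b) - h * (a * b)\<bar> \<le> (\<bar>c1\<bar> + \<bar>c2\<bar> + C * d) * (?s * ?t)"
    by (simp only: distrib_right)
qed (use assms(4,5) in auto)

text \<open>The weights add up to 1, so the combination is at most its largest member. This plays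
  the part of Hoelder's inequality: an exponential of dependent terms becomes a sum of exponentials,
  each integrable by its own argument.\<close>

lemma exp_convex_combination_le:
  fixes A B1 B2 :: real
  assumes "0 \<le> \<theta>" "\<theta> \<le> 1"
  shows "exp (\<theta> * A + (1 - \<theta>) / 2 * B1 + (1 - \<theta>) / 2 * B2) \<le> exp A + exp B1 + exp B2"
proof -
  define m where "m = max A (max B1 B2)"
  have "\<theta> * A + (1 - \<theta>) / 2 * B1 + (1 - \<theta>) / 2 * B2 \<le> \<theta> * m + (1 - \<theta>) / 2 * m + (1 - \<theta>) / 2 * m"
    using assms by (intro add_mono mult_left_mono) (auto simp: m_def)
  also have "\<dots> = m" by (simp add: field_simps)
  finally have "exp (\<theta> * A + (1 - \<theta>) / 2 * B1 + (1 - \<theta>) / 2 * B2) \<le> exp m" by simp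
  also have "\<dots> \<le> exp A + exp B1 + exp B2"
    unfolding m_def max_def by (auto intro: add_increasing add_increasing2)
  finally show ?thesis .
qed

section \<open>Boundedness of the truncated second moment\<close>

lemma eventually_const_le_mult_power2:
  fixes c d :: real
  assumes "d > 0"
  shows "\<forall>\<^sub>F n in sequentially. c \<le> d * (real n)\<^sup>2"
  using assms by real_asymp

lemma eventually_const_mult_sqrt_div_le:
  fixes c e :: real
  assumes "e > 0"
  shows "\<forall>\<^sub>F n in sequentially. c * (sqrt (real n) / real n) \<le> e"
proof -
  have "(\<lambda>n. c * (sqrt (real n) / real n)) \<longlonglongrightarrow> 0" by real_asymp
  then have "\<forall>\<^sub>F n in sequentially. c * (sqrt (real n) / real n) < e" using assms by (rule order_tendstoD(2))
  then show ?thesis by eventually_elim simp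
qed

text \<open>Rewrites the exponent with weights \<theta>, (1 - \<theta>) / 2 and (1 - \<theta>) / 2.
  Dividing the cubic terms by their weight enlarges the coefficient \<open>T\<close> to
  \<open>2 * T / (1 - \<theta>)\<close>.\<close>

lemma exponent_split:
  fixes h lam \<theta> \<mu> m D T N E1 E2 c :: real
  assumes "h * lam\<^sup>2 \<le> \<theta> * \<mu>\<^sup>2" "m \<ge> 0" "\<theta> < 1"
  shows "h * lam\<^sup>2 * m / 2 * D\<^sup>2 + T * N * (E1 + E2) + c
    \<le> c + (\<theta> * (m * \<mu>\<^sup>2 / 2 * D\<^sup>2) + (1 - \<theta>) / 2 * (2 * T / (1 - \<theta>) * N * E1)
        + (1 - \<theta>) / 2 * (2 * T / (1 - \<theta>) * N * E2))"
proof -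
  have "h * lam\<^sup>2 * (m / 2 * D\<^sup>2) \<le> \<theta> * \<mu>\<^sup>2 * (m / 2 * D\<^sup>2)"
    using assms by (intro mult_right_mono) auto
  then have "h * lam\<^sup>2 * m / 2 * D\<^sup>2 \<le> \<theta> * (m * \<mu>\<^sup>2 / 2 * D\<^sup>2)" by (simp add: mult_ac)
  moreover have "(1 - \<theta>) / 2 * (2 * T / (1 - \<theta>) * N * E) = T * N * E" for E
    using assms(3) by (simp add: field_simps)
  ultimately show ?thesis by (simp add: distrib_left)
qed

text \<open>The powers of n combine as n^(-1) from the subgaussian constant, n^(3/2) from the cubic
  coefficient and n^(-1) from the squared norm of the entrywise square of \<open>x\<close>. The
  product has order n^(-1/2), so \<open>small\<close> holds eventually for every fixed
  \<open>t\<close>.\<close>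

lemma delocalized_subgaussian_bound:
  assumes sub: "subgaussian n (\<sigma>\<^sup>2 / real n) M" and "prob_space M" and sM: "sets M = sets (vec_space n)"
    and x: "delocalized K n x" and "t \<ge> 0" "n > 0"
    and small: "\<sigma>\<^sup>2 * t * K * (sqrt (real n) / real n) \<le> 1 / 4"
  shows "(\<integral>\<^sup>+y. ennreal (exp (t * (real n * sqrt (real n)) * (dot n (\<lambda>i. (x i)\<^sup>2) y)\<^sup>2)) \<partial>M) \<le> ennreal (sqrt 2)"
proof (rule subgaussian_exp_square[OF sub assms(2) sM])
  have "(\<Sum>i<n. ((x i)\<^sup>2)\<^sup>2) = (\<Sum>i<n. x i ^ 4)" by (simp flip: power_mult)
  also have "\<dots> \<le> K / real n" using x by (simp add: delocalized_def)
  finally have "\<sigma>\<^sup>2 / real n * (t * (real n * sqrt (real n))) * (\<Sum>i<n. ((x i)\<^sup>2)\<^sup>2)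
    \<le> \<sigma>\<^sup>2 / real n * (t * (real n * sqrt (real n))) * (K / real n)"
    using assms(5) by (intro mult_left_mono) auto
  also have "\<dots> = \<sigma>\<^sup>2 * t * K * (sqrt (real n) / real n)" using assms(6) by (simp add: field_simps)
  also note small
  finally show "\<sigma>\<^sup>2 / real n * (t * (real n * sqrt (real n))) * (\<Sum>i<n. ((x i)\<^sup>2)\<^sup>2) \<le> 1 / 4" .
qed (use assms(5) in simp)

context wigner_model
begin

lemma truncated_likelihood_second_moment:
  assumes prob: "\<And>n. prob_space (X n)" and sX: "\<And>n. sets (X n) = sets (vec_space n)"
    and sub: "\<And>n. subgaussian n (\<sigma>\<^sup>2 / real n) (X n)"
    and C4: "translation_C4_near_0 P p" "translation_C4_near_0 Pd pd"
    and diff: "\<And>w. p differentiable (at w)"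
    and "lam \<ge> 0" "0 \<le> \<theta>" "\<theta> < 1" and fisher: "fisher_information P p * lam\<^sup>2 \<le> \<theta> * \<mu>\<^sup>2"
    and mu: "\<forall>\<^sub>F n in sequentially. (\<integral>\<^sup>+ (x, x'). ennreal (exp (real n * \<mu>\<^sup>2 / 2 * (dot n x x')\<^sup>2)) \<partial>(X n \<Otimes>\<^sub>M X n)) \<le> ennreal C0"
  obtains k where "k \<ge> 0" "\<forall>\<^sub>F n in sequentially.
      (\<integral>\<^sup>+x. \<integral>\<^sup>+y. indicator {x \<in> space (X n). delocalized K n x} x * indicator {x \<in> space (X n). delocalized K n x} y *
        (\<integral>\<^sup>+w. wigner_likelihood lam p pd n x w * wigner_likelihood lam p pd n y w \<partial>wigner_noise P Pd n) \<partial>X n \<partial>X n)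
      \<le> ennreal k"
proof -
  obtain h c1 c2 C d1 where C: "C \<ge> 0" and d1: "d1 > 0" and
    exps: "\<And>a b. \<bar>a\<bar> \<le> d1 \<Longrightarrow> \<bar>b\<bar> \<le> d1 \<Longrightarrow> integrable P (translation_integrand p (a, b)) \<and>
       \<bar>translation_function P p (a, b) - h * (a * b) - c1 * (a\<^sup>2 * b) - c2 * (a * b\<^sup>2)\<bar>
         \<le> C * (\<bar>a\<bar> * \<bar>b\<bar> * (a\<^sup>2 + b\<^sup>2))"
    by (rule translation_function_expansion[OF prob_P nv C4(1)]) (rule that)
  obtain C' d2 where C': "C' \<ge> 0" and d2: "d2 > 0" and
    expd: "\<And>a b. \<bar>a\<bar> \<le> d2 \<Longrightarrow> \<bar>b\<bar> \<le> d2 \<Longrightarrow> integrable Pd (translation_integrand pd (a, b)) \<and>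
       \<bar>translation_function Pd pd (a, b)\<bar> \<le> C' * (\<bar>a\<bar> * \<bar>b\<bar>)"
    by (rule translation_function_le_product[OF prob_Pd nvd C4(2)]) (rule that)
  have "h \<le> fisher_information P p"
    by (rule expansion_coefficient_le_fisher[OF prob_P nv diff C d1 exps])
  then have "h * lam\<^sup>2 \<le> fisher_information P p * lam\<^sup>2" by (intro mult_right_mono) auto
  then have h: "h * lam\<^sup>2 \<le> \<theta> * \<mu>\<^sup>2" using fisher by linarith
  define d where "d = min d1 d2"
  have d: "d > 0" "d \<le> d1" "d \<le> d2" using d1 d2 by (auto simp: d_def)
  define T where "T = (\<bar>c1\<bar> + \<bar>c2\<bar>) * lam ^ 3"
  define c where "c = \<bar>h\<bar> * lam\<^sup>2 * K + (\<bar>c1\<bar> + \<bar>c2\<bar>) * lam ^ 3 * K + 2 * C * lam ^ 4 * K\<^sup>2 + C' * lam\<^sup>2 * K"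
  define t where "t = 2 * T / (1 - \<theta>)"
  have t0: "t \<ge> 0" using assms(7,9) by (simp add: t_def T_def)
  define B where "B n = {x \<in> space (X n). delocalized K n x}" for n
  have B: "B n \<in> sets (X n)" for n unfolding B_def by (rule delocalized_sets[OF sX])
  let ?g = "\<lambda>n x y. ennreal (exp (t * (real n * sqrt (real n)) * (dot n (\<lambda>i. (x i)\<^sup>2) y)\<^sup>2))"
  let ?f = "\<lambda>n x y. ennreal (exp (real n * \<mu>\<^sup>2 / 2 * (dot n x y)\<^sup>2))"
  \<comment> \<open>In each cubic term on the right only the squared spike keeps its indicator. The
    other spike is then integrated over its full law, to which the subgaussian bound refers.\<close>
  have pointwise: "indicator (B n) x * indicator (B n) y *
        (\<integral>\<^sup>+w. wigner_likelihood lam p pd n x w * wigner_likelihood lam p pd n y w \<partial>wigner_noise P Pd n)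
      \<le> ennreal (exp c) * (?f n x y + indicator (B n) x * ?g n x y + indicator (B n) y * ?g n y x)"
    if n: "lam ^ 8 * K\<^sup>2 \<le> d ^ 8 * (real n)\<^sup>2" for n x y
  proof (cases "x \<in> B n \<and> y \<in> B n")
    case True
    then have x: "delocalized K n x" and y: "delocalized K n y" by (auto simp: B_def)
    let ?s = "lam * sqrt (real n)"
    have small: "\<bar>?s * (z i * z j)\<bar> \<le> d" if "delocalized K n z" "i < n" "j < n" for z i j
      by (rule delocalized_entry_bound[OF that d(1) n])
    have small1: "\<bar>?s * (z i * z j)\<bar> \<le> d1" "\<bar>?s * (z i * z j)\<bar> \<le> d2"
      if "delocalized K n z" "i < n" "j < n" for z i j
      using small[OF that] d by linarith+
    let ?sum = "\<Sum>j<n. (\<Sum>i<j. translation_function P p (?s * (x i * x j), ?s * (y i * y j)))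
        + translation_function Pd pd (?s * (x j * x j), ?s * (y j * y j))"
    have "?sum \<le> h * lam\<^sup>2 * real n / 2 * (dot n x y)\<^sup>2
      + (\<bar>c1\<bar> + \<bar>c2\<bar>) * lam ^ 3 * (real n * sqrt (real n)) *
          ((dot n (\<lambda>i. (x i)\<^sup>2) y)\<^sup>2 + (dot n (\<lambda>i. (y i)\<^sup>2) x)\<^sup>2) + c"
      unfolding c_def
    proof (rule sum_translation_le[OF x y d(1) C C' assms(7) n])
      fix a b assume ab: "\<bar>a\<bar> \<le> d" "\<bar>b\<bar> \<le> d"
      show "\<bar>translation_function P p (a, b) - h * (a * b) - c1 * (a\<^sup>2 * b) - c2 * (a * b\<^sup>2)\<bar>
         \<le> C * (\<bar>a\<bar> * \<bar>b\<bar> * (a\<^sup>2 + b\<^sup>2))"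
        using exps[of a b] ab d(2) by (meson order_trans)
      show "\<bar>translation_function Pd pd (a, b)\<bar> \<le> C' * (\<bar>a\<bar> * \<bar>b\<bar>)"
        using expd[of a b] ab d(3) by (meson order_trans)
    qed
    also have "\<dots> \<le> c + (\<theta> * (real n * \<mu>\<^sup>2 / 2 * (dot n x y)\<^sup>2)
        + (1 - \<theta>) / 2 * (t * (real n * sqrt (real n)) * (dot n (\<lambda>i. (x i)\<^sup>2) y)\<^sup>2)
        + (1 - \<theta>) / 2 * (t * (real n * sqrt (real n)) * (dot n (\<lambda>i. (y i)\<^sup>2) x)\<^sup>2))"
      unfolding t_def T_def[symmetric] by (rule exponent_split[OF h _ assms(9)]) simp
    finally have "exp ?sum \<le> exp c * exp (\<theta> * (real n * \<mu>\<^sup>2 / 2 * (dot n x y)\<^sup>2)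
        + (1 - \<theta>) / 2 * (t * (real n * sqrt (real n)) * (dot n (\<lambda>i. (x i)\<^sup>2) y)\<^sup>2)
        + (1 - \<theta>) / 2 * (t * (real n * sqrt (real n)) * (dot n (\<lambda>i. (y i)\<^sup>2) x)\<^sup>2))"
      by (simp flip: exp_add)
    also have "\<dots> \<le> exp c * (exp (real n * \<mu>\<^sup>2 / 2 * (dot n x y)\<^sup>2)
        + exp (t * (real n * sqrt (real n)) * (dot n (\<lambda>i. (x i)\<^sup>2) y)\<^sup>2)
        + exp (t * (real n * sqrt (real n)) * (dot n (\<lambda>i. (y i)\<^sup>2) x)\<^sup>2))"
      using assms(8,9) by (intro mult_left_mono exp_convex_combination_le) auto
    finally have "ennreal (exp ?sum) \<le> ennreal (exp c) * (?f n x y + ?g n x y + ?g n y x)"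
      by (simp add: ennreal_leI flip: ennreal_plus ennreal_mult)
    moreover have "(\<integral>\<^sup>+w. wigner_likelihood lam p pd n x w * wigner_likelihood lam p pd n y w \<partial>wigner_noise P Pd n)
      = ennreal (exp ?sum)"
      by (intro nn_integral_wigner_likelihood conjunct1[OF exps] conjunct1[OF expd] small1[OF x] small1[OF y])
    ultimately show ?thesis using True by simp
  qed auto
  \<comment> \<open>\<open>C0\<close> carries no sign; nonnegativity lets \<open>ennreal\<close>
    commute with the sum defining \<open>k\<close>.\<close>
  define C1 where "C1 = max C0 0"
  have C1: "C1 \<ge> 0" "C0 \<le> C1" by (auto simp: C1_def)
  define k where "k = exp c * (C1 + sqrt 2 + sqrt 2)"
  show thesis
  proof (rule that[of k])
    have "\<forall>\<^sub>F n in sequentially. lam ^ 8 * K\<^sup>2 \<le> d ^ 8 * (real n)\<^sup>2"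
      using d(1) by (intro eventually_const_le_mult_power2) simp
    moreover have "\<forall>\<^sub>F n in sequentially. \<sigma>\<^sup>2 * t * K * (sqrt (real n) / real n) \<le> 1 / 4"
      by (intro eventually_const_mult_sqrt_div_le) simp
    ultimately have "\<forall>\<^sub>F n in sequentially.
      (\<integral>\<^sup>+x. \<integral>\<^sup>+y. indicator (B n) x * indicator (B n) y *
        (\<integral>\<^sup>+w. wigner_likelihood lam p pd n x w * wigner_likelihood lam p pd n y w \<partial>wigner_noise P Pd n) \<partial>X n \<partial>X n)
      \<le> ennreal k"
      using mu eventually_gt_at_top[of 0]
    proof eventually_elim
      case (elim n)
      interpret X: prob_space "X n" by (rule prob)
      interpret XX: pair_sigma_finite "X n" "X n" ..
      note [measurable_cong] = sX[of n]
      note [measurable] = B[of n]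
      have sq [measurable]: "(\<lambda>z. dot n (\<lambda>i. (F z i)\<^sup>2) (G z)) \<in> borel_measurable M"
        if "F \<in> measurable M (X n)" "G \<in> measurable M (X n)" for F G M
        unfolding dot_def
        by (intro borel_measurable_sum borel_measurable_times borel_measurable_power
            measurable_compose[OF that(1) component_measurable[OF sX]]
            measurable_compose[OF that(2) component_measurable[OF sX]]) auto
      have sqb: "(\<integral>\<^sup>+x. \<integral>\<^sup>+y. indicator (B n) x * ?g n x y \<partial>X n \<partial>X n) \<le> ennreal (sqrt 2)"
      proof -
        have "(\<integral>\<^sup>+x. \<integral>\<^sup>+y. indicator (B n) x * ?g n x y \<partial>X n \<partial>X n) \<le> (\<integral>\<^sup>+x. ennreal (sqrt 2) \<partial>X n)"
        proof (rule nn_integral_mono)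
          fix x
          show "(\<integral>\<^sup>+y. indicator (B n) x * ?g n x y \<partial>X n) \<le> ennreal (sqrt 2)"
          proof (cases "x \<in> B n")
            case True
            then have "delocalized K n x" by (simp add: B_def)
            from delocalized_subgaussian_bound[OF sub prob sX this t0 elim(4,2)] True
            show ?thesis by simp
          qed simp
        qed
        then show ?thesis by (simp add: X.emeasure_space_1)
      qed
      \<comment> \<open>Exchanging the two independent spikes reduces this to the previous
        bound.\<close>
      have sqb': "(\<integral>\<^sup>+x. \<integral>\<^sup>+y. indicator (B n) y * ?g n y x \<partial>X n \<partial>X n) \<le> ennreal (sqrt 2)"
        by (subst XX.Fubini') (measurable, rule sqb)
      have main: "(\<integral>\<^sup>+x. \<integral>\<^sup>+y. ?f n x y \<partial>X n \<partial>X n) \<le> ennreal C1"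
      proof -
        have "(\<integral>\<^sup>+x. \<integral>\<^sup>+y. ?f n x y \<partial>X n \<partial>X n) = (\<integral>\<^sup>+ (x, y). ?f n x y \<partial>(X n \<Otimes>\<^sub>M X n))"
          by (subst X.nn_integral_fst[symmetric]) (auto simp: case_prod_unfold)
        also have "\<dots> \<le> ennreal C0" by (rule elim(3))
        also have "\<dots> \<le> ennreal C1" by (intro ennreal_leI C1)
        finally show ?thesis .
      qed
      have "(\<integral>\<^sup>+x. \<integral>\<^sup>+y. indicator (B n) x * indicator (B n) y *
          (\<integral>\<^sup>+w. wigner_likelihood lam p pd n x w * wigner_likelihood lam p pd n y w \<partial>wigner_noise P Pd n) \<partial>X n \<partial>X n)
        \<le> (\<integral>\<^sup>+x. \<integral>\<^sup>+y. ennreal (exp c) *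
            (?f n x y + indicator (B n) x * ?g n x y + indicator (B n) y * ?g n y x) \<partial>X n \<partial>X n)"
        by (intro nn_integral_mono pointwise elim(1))
      also have "\<dots> = ennreal (exp c) * ((\<integral>\<^sup>+x. \<integral>\<^sup>+y. ?f n x y \<partial>X n \<partial>X n)
          + (\<integral>\<^sup>+x. \<integral>\<^sup>+y. indicator (B n) x * ?g n x y \<partial>X n \<partial>X n)
          + (\<integral>\<^sup>+x. \<integral>\<^sup>+y. indicator (B n) y * ?g n y x \<partial>X n \<partial>X n))"
        by (simp add: nn_integral_cmult nn_integral_add cong: nn_integral_cong)
      also have "\<dots> \<le> ennreal (exp c) * (ennreal C1 + ennreal (sqrt 2) + ennreal (sqrt 2))"
        by (intro mult_left_mono add_mono main sqb sqb') simp
      also have "\<dots> = ennreal k" using C1(1) by (simp add: k_def flip: ennreal_plus ennreal_mult)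
      finally show ?case .
    qed
    then show "\<forall>\<^sub>F n in sequentially.
      (\<integral>\<^sup>+x. \<integral>\<^sup>+y. indicator {x \<in> space (X n). delocalized K n x} x * indicator {x \<in> space (X n). delocalized K n x} y *
        (\<integral>\<^sup>+w. wigner_likelihood lam p pd n x w * wigner_likelihood lam p pd n y w \<partial>wigner_noise P Pd n) \<partial>X n \<partial>X n)
      \<le> ennreal k" unfolding B_def .
  qed (use C1(1) in \<open>simp add: k_def\<close>)
qed

end

section \<open>Contiguity\<close>

context wigner_model
begin

lemma prob_space_Wig:
  assumes "prob_space (X n)" and sX: "sets (X n) = sets (vec_space n)"
  shows "prob_space (Wig lam P Pd X n)"
proof -
  interpret X: prob_space "X n" by fact
  interpret W: prob_space "wigner_noise P Pd n" by (rule prob_space_noise)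
  interpret XW: pair_prob_space "X n" "wigner_noise P Pd n" ..
  note [measurable_cong] = sX
  show ?thesis unfolding Wig_def case_prod_unfold by (rule XW.prob_space_distr) measurable
qed

text \<open>The level \<open>c\<close> is fixed in terms of \<open>e\<close> and \<open>k\<close>
  before n grows, so that c times the null probability still tends to 0.\<close>

lemma contiguous_Wig_of_second_moment:
  assumes prob: "\<And>n. prob_space (X n)" and sX: "\<And>n. sets (X n) = sets (vec_space n)"
    and B: "\<And>n. B n \<in> sets (X n)" and B1: "(\<lambda>n. measure (X n) (B n)) \<longlonglongrightarrow> 1" and "k \<ge> 0"
    and bound: "\<forall>\<^sub>F n in sequentially. (\<integral>\<^sup>+x. \<integral>\<^sup>+y. indicator (B n) x * indicator (B n) y *
      (\<integral>\<^sup>+w. wigner_likelihood lam p pd n x w * wigner_likelihood lam p pd n y w \<partial>wigner_noise P Pd n) \<partial>X n \<partial>X n)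
      \<le> ennreal k"
  shows "contiguous (Wig lam P Pd X) (Wig 0 P Pd X)"
  unfolding contiguous_def
proof (intro allI impI)
  fix A assume A0: "\<forall>n. A n \<in> sets (Wig 0 P Pd X n)" and lim: "(\<lambda>n. measure (Wig 0 P Pd X n) (A n)) \<longlonglongrightarrow> 0"
  from A0 have A: "A n \<in> sets (mat_space n)" for n by (simp add: Wig_def)
  show "(\<lambda>n. measure (Wig lam P Pd X n) (A n)) \<longlonglongrightarrow> 0"
  proof (rule order_tendstoI)
    fix e :: real assume "e < 0"
    then show "\<forall>\<^sub>F n in sequentially. e < measure (Wig lam P Pd X n) (A n)"
      by (intro always_eventually allI) (auto intro: less_le_trans)
  next
    fix e :: real assume e: "0 < e"
    \<comment> \<open>This makes \<open>k / c\<close> smaller than e / 3; the added 1 keeps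
      \<open>c\<close> positive when k = 0.\<close>
    define c where "c = 3 * k / e + 1"
    have c: "c > 0" "k * (1 / c) < e / 3"
      using e assms(5) by (auto simp: c_def field_simps intro!: add_pos_nonneg add_nonneg_pos)
    have "(\<lambda>n. (1 - measure (X n) (B n)) + c * measure (Wig 0 P Pd X n) (A n)) \<longlonglongrightarrow> (1 - 1) + c * 0"
      by (intro tendsto_intros B1 lim)
    then have "\<forall>\<^sub>F n in sequentially. (1 - measure (X n) (B n)) + c * measure (Wig 0 P Pd X n) (A n) < e / 3"
      using e by (intro order_tendstoD(2)) auto
    then show "\<forall>\<^sub>F n in sequentially. measure (Wig lam P Pd X n) (A n) < e"
      using bound eventually_gt_at_top[of 0]
    proof eventually_elim
      case (elim n)
      interpret X: prob_space "X n" by (rule prob)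
      interpret W0: prob_space "Wig 0 P Pd X n" by (rule prob_space_Wig[where X = X, OF prob sX])
      interpret W1: prob_space "Wig lam P Pd X n" by (rule prob_space_Wig[where X = X, OF prob sX])
      have "emeasure (Wig lam P Pd X n) (A n) \<le> emeasure (X n) (space (X n) - B n)
          + (ennreal c * emeasure (Wig 0 P Pd X n) (A n) + ennreal k * ennreal (1 / c))"
        by (rule emeasure_Wig_le[where X = X, OF prob sX A elim(3) c(1) B elim(2)])
      also have "\<dots> = ennreal ((1 - measure (X n) (B n)) + (c * measure (Wig 0 P Pd X n) (A n) + k * (1 / c)))"
        using c(1) assms(5) X.prob_le_1
        by (simp add: X.emeasure_eq_measure W0.emeasure_eq_measure X.prob_compl[OF B] flip: ennreal_mult ennreal_plus)
      finally have "measure (Wig lam P Pd X n) (A n)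
        \<le> (1 - measure (X n) (B n)) + (c * measure (Wig 0 P Pd X n) (A n) + k * (1 / c))"
        unfolding W1.emeasure_eq_measure
        using c(1) assms(5) X.prob_le_1 by (subst (asm) ennreal_le_iff) auto
      then show ?case using elim(1) c(2) e by linarith
    qed
  qed
qed

end

lemma fisher_information_nonneg: "fisher_information P p \<ge> 0"
  unfolding fisher_information_def by (rule integral_nonneg_AE) simp

text \<open>A number strictly below a supremum is exceeded by a member of the set: some admissible
  \<mu> lies beyond \<open>lam * sqrt F\<close>. The ratio \<theta> = F lam^2 / \<mu>^2 is then less
  than 1 and leaves room for the cubic terms.\<close>

lemma below_lambda_star:
  assumes prob: "\<And>n. prob_space (X n)" and "lam \<ge> 0" "F \<ge> 0"
    and less: "ereal lam < lambda_star X / ereal (sqrt F)"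
  obtains \<mu> \<theta> C where "0 \<le> \<theta>" "\<theta> < 1" "F * lam\<^sup>2 \<le> \<theta> * \<mu>\<^sup>2"
    "\<forall>\<^sub>F n in sequentially. (\<integral>\<^sup>+ (x, x'). ennreal (exp (real n * \<mu>\<^sup>2 / 2 * (dot n x x')\<^sup>2)) \<partial>(X n \<Otimes>\<^sub>M X n)) \<le> ennreal C"
proof (cases "F = 0")
  case True
  \<comment> \<open>For F = 0, where the quotient in \<open>less\<close> is a division by 0, the
    choice \<mu> = 0 works directly: the integrand is constantly 1.\<close>
  have "(\<integral>\<^sup>+ (x, x'). ennreal (exp (real n * 0\<^sup>2 / 2 * (dot n x x')\<^sup>2)) \<partial>(X n \<Otimes>\<^sub>M X n)) \<le> ennreal 1" for n
  proof -
    interpret X: prob_space "X n" by (rule prob)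
    interpret pair_prob_space "X n" "X n" ..
    show ?thesis by (simp add: case_prod_unfold emeasure_space_1)
  qed
  then show thesis using True by (intro that[of 0 0 1]) auto
next
  case False
  then have F: "F > 0" using assms(3) by simp
  have "ereal (lam * sqrt F) < lambda_star X"
    using less F by (simp add: ereal_less_divide_pos mult.commute)
  then obtain \<mu> where \<mu>: "lam * sqrt F < \<mu>" and
    "\<exists>C. \<forall>\<^sub>F n in sequentially. (\<integral>\<^sup>+ (x, x'). ennreal (exp (real n * \<mu>\<^sup>2 / 2 * (dot n x x')\<^sup>2)) \<partial>(X n \<Otimes>\<^sub>M X n)) \<le> ennreal C"
    unfolding lambda_star_def less_SUP_iff by auto
  then obtain C where C: "\<forall>\<^sub>F n in sequentially.
      (\<integral>\<^sup>+ (x, x'). ennreal (exp (real n * \<mu>\<^sup>2 / 2 * (dot n x x')\<^sup>2)) \<partial>(X n \<Otimes>\<^sub>M X n)) \<le> ennreal C" by blast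
  have "0 \<le> lam * sqrt F" using assms(2,3) by simp
  then have "(lam * sqrt F)\<^sup>2 < \<mu>\<^sup>2" and \<mu>0: "\<mu> > 0" using \<mu> by (auto intro: power_strict_mono)
  then have lt: "F * lam\<^sup>2 < \<mu>\<^sup>2" using F by (simp add: power_mult_distrib mult.commute)
  show thesis
    by (rule that[of "F * lam\<^sup>2 / \<mu>\<^sup>2" \<mu> C]) (use lt F \<mu>0 C in auto)
qed

theorem theorem4p4:
  fixes X :: "nat \<Rightarrow> (nat \<Rightarrow> real) measure"
    and P Pd :: "real measure"
    and p pd :: "real \<Rightarrow> real"
    and \<sigma> lam :: real
  assumes "spike_prior X"
    and "prob_space P" and "prob_space Pd"
    and "prob_space.expectation P (\<lambda>w. w) = 0" and "prob_space.variance P (\<lambda>w. w) = 1"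
    and "\<And>n. subgaussian n (\<sigma>\<^sup>2 / real n) (X n)"
    and "\<And>q :: nat. q \<in> {2, 4, 6, 8} \<Longrightarrow>
           \<exists>\<alpha> :: real. (\<lambda>n. measure (X n)
             {x \<in> space (X n). lq_norm (real q) n x \<le> \<alpha> * real n powr (1 / real q - 1 / 2)}) \<longlonglongrightarrow> 1"
    and "nonvanishing_density P p" and "nonvanishing_density Pd pd"
    and "\<And>w. p differentiable (at w)"
    and "translation_C4_near_0 P p" and "translation_C4_near_0 Pd pd"
    and "lam \<ge> 0"
    and "ereal lam < lambda_star X / ereal (sqrt (fisher_information P p))"
  shows "contiguous (Wig lam P Pd X) (Wig 0 P Pd X)"
proof -
  interpret wigner_model P Pd p pd using assms(2,3,8,9) by (rule wigner_model.intro)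
  have prob: "prob_space (X n)" and sX: "sets (X n) = sets (vec_space n)" for n
    using assms(1) by (auto simp: spike_prior_def)
  obtain K where K: "(\<lambda>n. measure (X n) {x \<in> space (X n). delocalized K n x}) \<longlonglongrightarrow> 1"
    using delocalized_with_high_probability[OF prob sX assms(7)] .
  obtain \<mu> \<theta> C where mu: "0 \<le> \<theta>" "\<theta> < 1" "fisher_information P p * lam\<^sup>2 \<le> \<theta> * \<mu>\<^sup>2"
    "\<forall>\<^sub>F n in sequentially. (\<integral>\<^sup>+ (x, x'). ennreal (exp (real n * \<mu>\<^sup>2 / 2 * (dot n x x')\<^sup>2)) \<partial>(X n \<Otimes>\<^sub>M X n)) \<le> ennreal C"
    using below_lambda_star[OF prob assms(13) fisher_information_nonneg assms(14)] .
  obtain k where k: "k \<ge> 0" "\<forall>\<^sub>F n in sequentially.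
      (\<integral>\<^sup>+x. \<integral>\<^sup>+y. indicator {x \<in> space (X n). delocalized K n x} x * indicator {x \<in> space (X n). delocalized K n x} y *
        (\<integral>\<^sup>+w. wigner_likelihood lam p pd n x w * wigner_likelihood lam p pd n y w \<partial>wigner_noise P Pd n) \<partial>X n \<partial>X n)
      \<le> ennreal k"
    using truncated_likelihood_second_moment[OF prob sX assms(6,11,12,10,13) mu] .
  show ?thesis
    by (rule contiguous_Wig_of_second_moment[OF prob sX delocalized_sets[OF sX] K k])
qed

end
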